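(* Every formula of the hybrid $\mu$-calculus that has a valid $\mathbf{Saf}$-proof is semantically valid (true at every point of every Kripke model).
   Context: Formulas of the hybrid $\mu$-calculus: $\varphi ::= p \mid \neg p \mid \mathsf{i} \mid \neg\mathsf{i} \mid \varphi\vee\varphi \mid \varphi\wedge\varphi \mid \Diamond\varphi \mid \Box\varphi \mid @_{\mathsf{i}}\varphi \mid \mu x.\varphi \mid \nu x.\varphi$, with $p,x$ propositional variables and $\mathsf{i}$ nominals (countably infinite supplies); in $\eta x.\varphi$ ($\eta\in\{\mu,\nu\}$) $x$ occurs only positively and only in the scope of $\Box$ or $\Diamond$. $\mathsf{i}\approx\mathsf{j}:=@_{\mathsf{i}}\mathsf{j}$, $\mathsf{i}\not\approx\mathsf{j}:=@_{\mathsf{i}}\neg\mathsf{j}$. For bound variables $x,y$ of $\varphi$, $x<_\varphi y$ iff some subformula $\eta y.\psi$ has a free occurrence of $x$; formulas are locally well-named ($<_\varphi$ irreflexive, no variable both free and bound, none bound by both $\mu$ and $\nu$). Kripke models $(W,R,V,A)$ with $A$ assigning a point to each nominal; standard semantics, $[\![\mathsf{i}]\!]=\{A(\mathsf{i})\}$, $@_{\mathsf{i}}\varphi$ holds everywhere iff $\varphi$ holds at $A(\mathsf{i})$. The system $\mathbf{Saf}$ is parametrized by a strict linear order $<$ on fixpoint variables. Each variable $x$ has a countably infinite, fixed-enumerated supply of names $\mathsf{x}_0,\mathsf{x}_1,\dots$; for names, $\mathsf{x}<\mathsf{y}$ iff their variables satisfy $x<y$. For a word $\mathsf{a}$ of names,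 $\mathsf{a}\le x$ means $\mathsf{a}$ contains no name of a variable $y>x$; $\mathsf{a}\sqsubseteq\mathsf{b}$ means $\mathsf{a}$ is a subsequence of $\mathsf{b}$; $\mathsf{a}\sqcap\mathsf{b}$ is the longest common subsequence when unique. An annotated sequent is $\mathsf{a}\vdash @_{\mathsf{i}_1}\varphi_1^{\mathsf{b}_1},\dots,@_{\mathsf{i}_n}\varphi_n^{\mathsf{b}_n}$ where $\mathsf{a}$ (the control) and the annotations $\mathsf{b}_k$ are words of names without repetitions, each $\mathsf{b}_k$ is non-decreasing w.r.t. $<$, and $\mathsf{b}_k\sqsubseteq\mathsf{a}$. Axioms: $\varepsilon\vdash@_{\mathsf{i}}p^\varepsilon,@_{\mathsf{i}}\neg p^\varepsilon$ ($p$ a propositional variable or nominal) and $\varepsilon\vdash(\mathsf{i}\approx\mathsf{i})^\varepsilon$. Rules (premise(s) / conclusion): ($\wedge$) $\mathsf{a}\vdash\Gamma,@_{\mathsf{i}}(\varphi\wedge\psi)^{\mathsf{b}},@_{\mathsf{i}}\varphi^{\mathsf{b}}$ and $\mathsf{a}\vdash\Gamma,@_{\mathsf{i}}(\varphi\wedge\psi)^{\mathsf{b}},@_{\mathsf{i}}\psi^{\mathsf{b}}$ / $\mathsf{a}\vdash\Gamma,@_{\mathsf{i}}(\varphi\wedge\psi)^{\mathsf{b}}$; ($\vee$) $\mathsf{a}\vdash\Gamma,@_{\mathsf{i}}(\varphi\vee\psi)^{\mathsf{b}},@_{\mathsf{i}}\varphi^{\mathsf{b}},@_{\mathsf{i}}\psi^{\mathsf{b}}$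 / $\mathsf{a}\vdash\Gamma,@_{\mathsf{i}}(\varphi\vee\psi)^{\mathsf{b}}$; ($\mathsf{Eq}$) $\mathsf{a}\vdash\Gamma,@_{\mathsf{i}}\phi^{\mathsf{b}},@_{\mathsf{j}}\phi^{\mathsf{b}},(\mathsf{i}\not\approx\mathsf{j})^{\mathsf{c}}$ / $\mathsf{a}\vdash\Gamma,@_{\mathsf{j}}\phi^{\mathsf{b}},(\mathsf{i}\not\approx\mathsf{j})^{\mathsf{c}}$; ($\mathsf{Com}$) $\mathsf{a}\vdash\Gamma,(\mathsf{i}\not\approx\mathsf{j})^{\mathsf{c}},(\mathsf{j}\not\approx\mathsf{i})^{\mathsf{c}}$ / $\mathsf{a}\vdash\Gamma,(\mathsf{i}\not\approx\mathsf{j})^{\mathsf{c}}$; ($\mathsf{Mod}$) $\mathsf{a}\vdash\Gamma,@_{\mathsf{i}}\Box\varphi^{\mathsf{b}},@_{\mathsf{i}}\Diamond\Psi,@_{\mathsf{j}}\varphi^{\mathsf{b}},@_{\mathsf{j}}\Psi$ / $\mathsf{a}\vdash\Gamma,@_{\mathsf{i}}\Box\varphi^{\mathsf{b}},@_{\mathsf{i}}\Diamond\Psi$, with $\Psi$ a finite set of (annotated) formulas, each $@_{\mathsf{i}}\Diamond\psi$ of the conclusion giving $@_{\mathsf{j}}\psi$ in the premise, and $\mathsf{j}$ fresh; ($\eta x$) $\mathsf{a}\vdash\Gamma,@_{\mathsf{i}}\eta x.\phi(x)^{\mathsf{b}},@_{\mathsf{i}}\phi(\eta x.\phi(x))^{\mathsf{b}}$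 / $\mathsf{a}\vdash\Gamma,@_{\mathsf{i}}\eta x.\phi(x)^{\mathsf{b}}$, provided $\mathsf{b}\le x$; ($\mathsf{Glob}$) $\mathsf{a}\vdash\Gamma,@_{\mathsf{i}}@_{\mathsf{j}}\varphi^{\mathsf{b}},@_{\mathsf{j}}\varphi^{\mathsf{b}}$ / $\mathsf{a}\vdash\Gamma,@_{\mathsf{i}}@_{\mathsf{j}}\varphi^{\mathsf{b}}$; ($\mathsf{Rec}(\mathsf{x})$) $\mathsf{a}\mathsf{x}\vdash\Gamma,@_{\mathsf{i}}\nu x.\varphi(x)^{\mathsf{b}},@_{\mathsf{i}}\varphi(\nu x.\varphi(x))^{\mathsf{b}\mathsf{x}}$ / $\mathsf{a}\vdash\Gamma,@_{\mathsf{i}}\nu x.\varphi(x)^{\mathsf{b}}$, provided $\mathsf{b}\le x$ and $\mathsf{x}$ is a fresh name for $x$; ($\mathsf{Exp}$) $\mathsf{a}\vdash@_{\mathsf{i}_1}\varphi_1^{\mathsf{b}_1},\dots,@_{\mathsf{i}_n}\varphi_n^{\mathsf{b}_n}$ / $\mathsf{a}'\vdash@_{\mathsf{i}_1}\varphi_1^{\mathsf{b}'_1},\dots,@_{\mathsf{i}_n}\varphi_n^{\mathsf{b}'_n}$, provided $\mathsf{a}\sqsubseteq\mathsf{a}'$, $\mathsf{b}_k\sqsubseteq\mathsf{b}'_k$ and $\mathsf{b}'_k\sqcap\mathsf{a}\sqsubseteq\mathsf{b}_k$ for all $k$; ($\mathsf{Reset}(\mathsf{x})$) $\mathsf{a}\vdash\Gamma,@_{\mathsf{i}_1}\varphi_1^{\mathsf{b}\mathsf{x}},\dots,@_{\mathsf{i}_n}\varphi_n^{\mathsf{b}\mathsf{x}}$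 / $\mathsf{a}\vdash\Gamma,@_{\mathsf{i}_1}\varphi_1^{\mathsf{b}\mathsf{x}\mathsf{x}_1\mathsf{c}_1},\dots,@_{\mathsf{i}_n}\varphi_n^{\mathsf{b}\mathsf{x}\mathsf{x}_n\mathsf{c}_n}$, provided the name $\mathsf{x}$ does not occur in $\Gamma$ (the name $\mathsf{x}$ is then said to be reset); ($\mathsf{Weak}$) $\mathsf{a}\vdash\Gamma$ / $\mathsf{a}\vdash\Gamma\cup\Psi$. A $\mathbf{Saf}$-proof is a labelled tree of annotated sequents and rule instances in the usual way. A back-edge map of a finite $\mathbf{Saf}$-proof is a map $f$ from non-axiom leaves to non-leaves such that $f(l)$ is an ancestor of $l$ with the same label; it is good if for each such $l$ there is a name $\mathsf{x}$ in the control of every node on the path from $f(l)$ to $l$ that is reset at least once on this path. A $\mathbf{Saf}$-proof is valid if it is finite and has a good back-edge map. A formula $\rho$ has a valid $\mathbf{Saf}$-proof if the annotated sequent $\varepsilon\vdash@_{\mathsf{r}}\rho^\varepsilon$, with $\mathsf{r}$ a nominal not in $\rho$, has a valid $\mathbf{Saf}$-proof where the parameter $<$ is an (arbitrary) linearization of $<_\rho$. *)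

theory Defs
  imports Main "HOL-Library.Sublist"
begin

section \<open>Hybrid mu-calculus: syntax\<close>

type_synonym pvar = nat
type_synonym nominal = nat

datatype fixop = Mu | Nu

datatype form =
    Prop pvar
  | NProp pvar
  | Nom nominal
  | NNom nominal
  | Or form form
  | And form form
  | Dia form
  | Box form
  | At nominal form
  | Fix fixop pvar form

primrec subforms :: "form \<Rightarrow> form set" where
  "subforms (Prop p) = {Prop p}"
| "subforms (NProp p) = {NProp p}"
| "subforms (Nom i) = {Nom i}"
| "subforms (NNom i) = {NNom i}"
| "subforms (Or \<phi> \<psi>) = insert (Or \<phi> \<psi>) (subforms \<phi> \<union> subforms \<psi>)"
| "subforms (And \<phi> \<psi>) = insert (And \<phi> \<psi>) (subforms \<phi> \<union> subforms \<psi>)"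
| "subforms (Dia \<phi>) = insert (Dia \<phi>) (subforms \<phi>)"
| "subforms (Box \<phi>) = insert (Box \<phi>) (subforms \<phi>)"
| "subforms (At i \<phi>) = insert (At i \<phi>) (subforms \<phi>)"
| "subforms (Fix \<eta> x \<phi>) = insert (Fix \<eta> x \<phi>) (subforms \<phi>)"

primrec noms :: "form \<Rightarrow> nominal set" where
  "noms (Prop p) = {}"
| "noms (NProp p) = {}"
| "noms (Nom i) = {i}"
| "noms (NNom i) = {i}"
| "noms (Or \<phi> \<psi>) = noms \<phi> \<union> noms \<psi>"
| "noms (And \<phi> \<psi>) = noms \<phi> \<union> noms \<psi>"
| "noms (Dia \<phi>) = noms \<phi>"
| "noms (Box \<phi>) = noms \<phi>"
| "noms (At i \<phi>) = insert i (noms \<phi>)"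
| "noms (Fix \<eta> x \<phi>) = noms \<phi>"

primrec fv :: "form \<Rightarrow> pvar set" where
  "fv (Prop p) = {p}"
| "fv (NProp p) = {p}"
| "fv (Nom i) = {}"
| "fv (NNom i) = {}"
| "fv (Or \<phi> \<psi>) = fv \<phi> \<union> fv \<psi>"
| "fv (And \<phi> \<psi>) = fv \<phi> \<union> fv \<psi>"
| "fv (Dia \<phi>) = fv \<phi>"
| "fv (Box \<phi>) = fv \<phi>"
| "fv (At i \<phi>) = fv \<phi>"
| "fv (Fix \<eta> x \<phi>) = fv \<phi> - {x}"

text \<open>Variables with a negated free occurrence.\<close>

primrec neg_fv :: "form \<Rightarrow> pvar set" where
  "neg_fv (Prop p) = {}"
| "neg_fv (NProp p) = {p}"
| "neg_fv (Nom i) = {}"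
| "neg_fv (NNom i) = {}"
| "neg_fv (Or \<phi> \<psi>) = neg_fv \<phi> \<union> neg_fv \<psi>"
| "neg_fv (And \<phi> \<psi>) = neg_fv \<phi> \<union> neg_fv \<psi>"
| "neg_fv (Dia \<phi>) = neg_fv \<phi>"
| "neg_fv (Box \<phi>) = neg_fv \<phi>"
| "neg_fv (At i \<phi>) = neg_fv \<phi>"
| "neg_fv (Fix \<eta> x \<phi>) = neg_fv \<phi> - {x}"

text \<open>Variables with a free occurrence that is not in the scope of a modality
  \<open>Dia\<close> or \<open>Box\<close> (the operator \<open>At\<close> does not guard).\<close>

primrec unguarded_fv :: "form \<Rightarrow> pvar set" where
  "unguarded_fv (Prop p) = {p}"
| "unguarded_fv (NProp p) = {p}"
| "unguarded_fv (Nom i) = {}"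
| "unguarded_fv (NNom i) = {}"
| "unguarded_fv (Or \<phi> \<psi>) = unguarded_fv \<phi> \<union> unguarded_fv \<psi>"
| "unguarded_fv (And \<phi> \<psi>) = unguarded_fv \<phi> \<union> unguarded_fv \<psi>"
| "unguarded_fv (Dia \<phi>) = {}"
| "unguarded_fv (Box \<phi>) = {}"
| "unguarded_fv (At i \<phi>) = unguarded_fv \<phi>"
| "unguarded_fv (Fix \<eta> x \<phi>) = unguarded_fv \<phi> - {x}"

definition bv_of :: "fixop \<Rightarrow> form \<Rightarrow> pvar set" where
  "bv_of \<eta> \<phi> = {x. \<exists>\<psi>. Fix \<eta> x \<psi> \<in> subforms \<phi>}"

definition bv :: "form \<Rightarrow> pvar set" where
  "bv \<phi> = bv_of Mu \<phi> \<union> bv_of Nu \<phi>"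

definition dep :: "form \<Rightarrow> (pvar \<times> pvar) set" where
  "dep \<phi> = {(x, y). x \<in> bv \<phi> \<and> y \<in> bv \<phi> \<and>
              (\<exists>\<eta> \<psi>. Fix \<eta> y \<psi> \<in> subforms \<phi> \<and> x \<in> fv (Fix \<eta> y \<psi>))}"

text \<open>The generating relation \<open>dep \<phi>\<close> is irreflexive for trivial reasons, so irreflexivity of the
  dependency order is understood for its transitive closure. This is necessary (and, the set of
  bound variables being finite, sufficient) for the existence of a linearization.\<close>

definition locally_well_named :: "form \<Rightarrow> bool" where
  "locally_well_named \<phi> \<longleftrightarrow>
     irrefl ((dep \<phi>)\<^sup>+) \<and> fv \<phi> \<inter> bv \<phi> = {} \<and> bv_of Mu \<phi> \<inter> bv_of Nu \<phi> = {}"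

definition formula :: "form \<Rightarrow> bool" where
  "formula \<phi> \<longleftrightarrow>
     (\<forall>\<eta> x \<psi>. Fix \<eta> x \<psi> \<in> subforms \<phi> \<longrightarrow> x \<notin> neg_fv \<psi> \<and> x \<notin> unguarded_fv \<psi>) \<and>
     locally_well_named \<phi>"

text \<open>\<open>subst \<phi> x \<theta>\<close> replaces the free positive occurrences of \<open>x\<close> in \<open>\<phi>\<close> by \<open>\<theta>\<close>. It is only
  used to unfold a fixpoint formula \<open>Fix \<eta> x \<phi>\<close>, where \<open>x\<close> is positive in \<open>\<phi>\<close> and where variable
  capture is impossible because no variable is both free and bound in \<open>Fix \<eta> x \<phi>\<close>.\<close>

primrec subst :: "form \<Rightarrow> pvar \<Rightarrow> form \<Rightarrow> form" where
  "subst (Prop p) x \<theta> = (if p = x then \<theta> else Prop p)"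
| "subst (NProp p) x \<theta> = NProp p"
| "subst (Nom i) x \<theta> = Nom i"
| "subst (NNom i) x \<theta> = NNom i"
| "subst (Or \<phi> \<psi>) x \<theta> = Or (subst \<phi> x \<theta>) (subst \<psi> x \<theta>)"
| "subst (And \<phi> \<psi>) x \<theta> = And (subst \<phi> x \<theta>) (subst \<psi> x \<theta>)"
| "subst (Dia \<phi>) x \<theta> = Dia (subst \<phi> x \<theta>)"
| "subst (Box \<phi>) x \<theta> = Box (subst \<phi> x \<theta>)"
| "subst (At i \<phi>) x \<theta> = At i (subst \<phi> x \<theta>)"
| "subst (Fix \<eta> y \<phi>) x \<theta> = (if y = x then Fix \<eta> y \<phi> else Fix \<eta> y (subst \<phi> x \<theta>))"

definition unfold_fix :: "fixop \<Rightarrow> pvar \<Rightarrow> form \<Rightarrow> form" where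
  "unfold_fix \<eta> x \<phi> = subst \<phi> x (Fix \<eta> x \<phi>)"


section \<open>Kripke semantics\<close>

record 'w kripke =
  worlds :: "'w set"
  acc :: "('w \<times> 'w) set"
  val :: "pvar \<Rightarrow> 'w set"
  assign :: "nominal \<Rightarrow> 'w"

definition kripke_model :: "'w kripke \<Rightarrow> bool" where
  "kripke_model M \<longleftrightarrow>
     acc M \<subseteq> worlds M \<times> worlds M \<and> (\<forall>p. val M p \<subseteq> worlds M) \<and> (\<forall>i. assign M i \<in> worlds M)"

text \<open>Fixpoints are taken in the lattice of subsets of \<open>worlds M\<close> (Knaster-Tarski).\<close>

primrec sem :: "form \<Rightarrow> 'w kripke \<Rightarrow> 'w set" where
  "sem (Prop p) M = val M p"
| "sem (NProp p) M = worlds M - val M p"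
| "sem (Nom i) M = {assign M i}"
| "sem (NNom i) M = worlds M - {assign M i}"
| "sem (Or \<phi> \<psi>) M = sem \<phi> M \<union> sem \<psi> M"
| "sem (And \<phi> \<psi>) M = sem \<phi> M \<inter> sem \<psi> M"
| "sem (Dia \<phi>) M = {w \<in> worlds M. \<exists>v. (w, v) \<in> acc M \<and> v \<in> sem \<phi> M}"
| "sem (Box \<phi>) M = {w \<in> worlds M. \<forall>v. (w, v) \<in> acc M \<longrightarrow> v \<in> sem \<phi> M}"
| "sem (At i \<phi>) M = {w \<in> worlds M. assign M i \<in> sem \<phi> M}"
| "sem (Fix \<eta> x \<phi>) M =
     (case \<eta> of
        Mu \<Rightarrow> \<Inter>{X. X \<subseteq> worlds M \<and> sem \<phi> (M\<lparr>val := (val M)(x := X)\<rparr>) \<subseteq> X}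
      | Nu \<Rightarrow> \<Union>{X. X \<subseteq> worlds M \<and> X \<subseteq> sem \<phi> (M\<lparr>val := (val M)(x := X)\<rparr>)})"


section \<open>Annotated sequents\<close>

text \<open>\<open>(x, n)\<close> is the \<open>n\<close>-th name of the variable \<open>x\<close>.\<close>

type_synonym name = "pvar \<times> nat"

text \<open>\<open>(i, \<phi>, b)\<close> stands for the formula \<open>At i \<phi>\<close> with annotation \<open>b\<close>. Sequents are finite sets of
  such annotated formulas (finiteness is part of \<open>is_sequent\<close>) together with a control.\<close>

type_synonym aform = "nominal \<times> form \<times> name list"
type_synonym sequent = "name list \<times> aform set"

type_synonym var_order = "(pvar \<times> pvar) set"

definition non_decreasing :: "var_order \<Rightarrow> name list \<Rightarrow> bool" where
  "non_decreasing lt b \<longleftrightarrow> sorted_wrt (\<lambda>u v. (fst v, fst u) \<notin> lt) b"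

definition word_le_var :: "var_order \<Rightarrow> name list \<Rightarrow> pvar \<Rightarrow> bool" where
  "word_le_var lt b x \<longleftrightarrow> (\<forall>u \<in> set b. (x, fst u) \<notin> lt)"

definition is_sequent :: "var_order \<Rightarrow> sequent \<Rightarrow> bool" where
  "is_sequent lt S \<longleftrightarrow>
     (case S of (a, \<Gamma>) \<Rightarrow>
        distinct a \<and> finite \<Gamma> \<and>
        (\<forall>(i, \<phi>, b) \<in> \<Gamma>. formula \<phi> \<and> distinct b \<and> non_decreasing lt b \<and> subseq b a))"

definition longest_common_subseq :: "'a list \<Rightarrow> 'a list \<Rightarrow> 'a list \<Rightarrow> bool" where
  "longest_common_subseq a b c \<longleftrightarrow>
     subseq c a \<and> subseq c b \<and> (\<forall>d. subseq d a \<and> subseq d b \<longrightarrow> length d \<le> length c)"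

definition word_meet :: "'a list \<Rightarrow> 'a list \<Rightarrow> 'a list" where
  "word_meet a b = (THE c. longest_common_subseq a b c)"

text \<open>Where \<open>word_meet\<close> is used below, both arguments are subsequences of a common word without
  repetitions, so that the longest common subsequence is indeed unique.\<close>

lemma subseq_set_subset: "subseq c a \<Longrightarrow> set c \<subseteq> set a"
  by (induction rule: list_emb.induct) auto

lemma subseq_distinct_eq_filter:
  "subseq c a \<Longrightarrow> distinct a \<Longrightarrow> filter (\<lambda>u. u \<in> set c) a = c"
proof (induction a arbitrary: c)
  case Nil
  then show ?case by (cases c) simp_all
next
  case (Cons y ys)
  have dist: "distinct ys" "y \<notin> set ys" using Cons.prems(2) by simp_all
  show ?case
  proof (cases "subseq c ys")
    case True
    then have "y \<notin> set c" using subseq_set_subset dist(2) by blast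
    then show ?thesis using Cons.IH[OF True dist(1)] by simp
  next
    case False
    obtain d where c: "c = y # d" and d: "subseq d ys"
    proof (cases c)
      case Nil
      with False show ?thesis by simp
    next
      case c: (Cons z zs)
      have "z = y" using False Cons.prems(1) subseq_Cons2_neq unfolding c by metis
      moreover from this have "subseq zs ys" using Cons.prems(1) subseq_Cons2' unfolding c by metis
      ultimately show ?thesis using that c by blast
    qed
    have "filter (\<lambda>u. u \<in> set c) ys = filter (\<lambda>u. u \<in> set d) ys"
      by (rule filter_cong) (use c dist(2) in auto)
    then show ?thesis using Cons.IH[OF d dist(1)] c by simp
  qed
qed

lemma longest_common_subseq_unique:
  assumes "distinct w" "subseq a w" "subseq b w"
  shows "\<exists>!c. longest_common_subseq a b c"
proof -
  define m where "m = filter (\<lambda>u. u \<in> set a \<and> u \<in> set b) w"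
  have eqs: "filter (\<lambda>u. u \<in> set c) w = c" if "subseq c w" for c
    using subseq_distinct_eq_filter[OF that assms(1)] .
  have mono: "subseq (filter P w) (filter Q w)" if "\<And>u. P u \<Longrightarrow> Q u" for P Q
  proof -
    have "filter P (filter Q w) = filter P w"
      unfolding filter_filter by (rule filter_cong) (use that in auto)
    then show ?thesis using subseq_filter_left[of P "filter Q w"] by simp
  qed
  have "subseq m (filter (\<lambda>u. u \<in> set a) w)" "subseq m (filter (\<lambda>u. u \<in> set b) w)"
    unfolding m_def by (rule mono, simp)+
  then have ma: "subseq m a" and mb: "subseq m b"
    unfolding eqs[OF assms(2)] eqs[OF assms(3)] .
  have max: "subseq c m" if ca: "subseq c a" and cb: "subseq c b" for c
  proof -
    have cw: "subseq c w" using ca assms(2) by (rule subseq_order.order_trans)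
    have "subseq (filter (\<lambda>u. u \<in> set c) w) m"
      unfolding m_def
      by (rule mono) (use subseq_set_subset[OF ca] subseq_set_subset[OF cb] in blast)
    then show ?thesis unfolding eqs[OF cw] .
  qed
  show ?thesis
  proof (rule ex1I[of _ m])
    show "longest_common_subseq a b m"
      unfolding longest_common_subseq_def using ma mb max list_emb_length by blast
  next
    fix c assume "longest_common_subseq a b c"
    then have "subseq c m" "length m \<le> length c"
      unfolding longest_common_subseq_def using ma mb max by blast+
    moreover from this have "length c = length m" using list_emb_length le_antisym by blast
    ultimately show "c = m" using subseq_same_length by blast
  qed
qed


section \<open>The rules of Saf\<close>

inductive saf_axiom :: "sequent \<Rightarrow> bool" where
  ax_prop: "saf_axiom ([], {(i, Prop p, []), (i, NProp p, [])})"
| ax_nom: "saf_axiom ([], {(i, Nom j, []), (i, NNom j, [])})"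
| ax_refl: "saf_axiom ([], {(i, Nom i, [])})"

datatype rule = RAnd | ROr | REq | RCom | RMod | RFix pvar | RGlob | RRec name | RExp
  | RReset name | RWeak

definition seq_noms :: "aform set \<Rightarrow> nominal set" where
  "seq_noms \<Gamma> = (\<Union>(i, \<phi>, b) \<in> \<Gamma>. insert i (noms \<phi>))"

definition name_occurs :: "name \<Rightarrow> aform set \<Rightarrow> bool" where
  "name_occurs u \<Gamma> \<longleftrightarrow> (\<exists>(i, \<phi>, b) \<in> \<Gamma>. u \<in> set b)"

text \<open>\<open>saf_rule lt r Ps C\<close>: with order \<open>lt\<close>, there is an instance of rule \<open>r\<close> with premises \<open>Ps\<close>
  and conclusion \<open>C\<close>; that all of these are annotated sequents is imposed in \<open>saf_proof\<close>.
  In \<open>exp\<close> and \<open>reset\<close> the set \<open>\<Delta>\<close> collects the data indexed by \<open>1, \<dots>, n\<close>.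
  In \<open>reset\<close>, the names following \<open>u\<close> are names of the same variable as \<open>u\<close>, and at least one
  annotation has to be cut off: an instance with \<open>n = 0\<close> would reset a name no formula carries.\<close>

inductive saf_rule :: "var_order \<Rightarrow> rule \<Rightarrow> sequent list \<Rightarrow> sequent \<Rightarrow> bool" for lt where
  conj: "saf_rule lt RAnd
     [(a, \<Gamma> \<union> {(i, And \<phi> \<psi>, b), (i, \<phi>, b)}), (a, \<Gamma> \<union> {(i, And \<phi> \<psi>, b), (i, \<psi>, b)})]
     (a, \<Gamma> \<union> {(i, And \<phi> \<psi>, b)})"
| disj: "saf_rule lt ROr
     [(a, \<Gamma> \<union> {(i, Or \<phi> \<psi>, b), (i, \<phi>, b), (i, \<psi>, b)})]
     (a, \<Gamma> \<union> {(i, Or \<phi> \<psi>, b)})"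
| eq: "saf_rule lt REq
     [(a, \<Gamma> \<union> {(i, \<phi>, b), (j, \<phi>, b), (i, NNom j, c)})]
     (a, \<Gamma> \<union> {(j, \<phi>, b), (i, NNom j, c)})"
| com: "saf_rule lt RCom
     [(a, \<Gamma> \<union> {(i, NNom j, c), (j, NNom i, c)})]
     (a, \<Gamma> \<union> {(i, NNom j, c)})"
| modal: "j \<notin> seq_noms (\<Gamma> \<union> {(i, Box \<phi>, b)} \<union> {(i, Dia \<psi>, c) | \<psi> c. (\<psi>, c) \<in> \<Psi>}) \<Longrightarrow>
   saf_rule lt RMod
     [(a, \<Gamma> \<union> {(i, Box \<phi>, b)} \<union> {(i, Dia \<psi>, c) | \<psi> c. (\<psi>, c) \<in> \<Psi>}
            \<union> {(j, \<phi>, b)} \<union> {(j, \<psi>, c) | \<psi> c. (\<psi>, c) \<in> \<Psi>})]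
     (a, \<Gamma> \<union> {(i, Box \<phi>, b)} \<union> {(i, Dia \<psi>, c) | \<psi> c. (\<psi>, c) \<in> \<Psi>})"
| fixp: "word_le_var lt b x \<Longrightarrow>
   saf_rule lt (RFix x)
     [(a, \<Gamma> \<union> {(i, Fix \<eta> x \<phi>, b), (i, unfold_fix \<eta> x \<phi>, b)})]
     (a, \<Gamma> \<union> {(i, Fix \<eta> x \<phi>, b)})"
| glob: "saf_rule lt RGlob
     [(a, \<Gamma> \<union> {(i, At j \<phi>, b), (j, \<phi>, b)})]
     (a, \<Gamma> \<union> {(i, At j \<phi>, b)})"
| rec_nu: "word_le_var lt b x \<Longrightarrow> (x, n) \<notin> set a \<Longrightarrow>
   saf_rule lt (RRec (x, n))
     [(a @ [(x, n)], \<Gamma> \<union> {(i, Fix Nu x \<phi>, b), (i, unfold_fix Nu x \<phi>, b @ [(x, n)])})]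
     (a, \<Gamma> \<union> {(i, Fix Nu x \<phi>, b)})"
| exp: "subseq a a' \<Longrightarrow>
   (\<forall>(i, \<phi>, b, b') \<in> \<Delta>. subseq b b' \<and> subseq (word_meet b' a) b) \<Longrightarrow>
   saf_rule lt RExp
     [(a, {(i, \<phi>, b) | i \<phi> b b'. (i, \<phi>, b, b') \<in> \<Delta>})]
     (a', {(i, \<phi>, b') | i \<phi> b b'. (i, \<phi>, b, b') \<in> \<Delta>})"
| reset: "\<not> name_occurs u \<Gamma> \<Longrightarrow> \<Delta> \<noteq> {} \<Longrightarrow> (\<forall>(i, \<phi>, v, c) \<in> \<Delta>. fst v = fst u) \<Longrightarrow>
   saf_rule lt (RReset u)
     [(a, \<Gamma> \<union> {(i, \<phi>, b @ [u]) | i \<phi> v c. (i, \<phi>, v, c) \<in> \<Delta>})]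
     (a, \<Gamma> \<union> {(i, \<phi>, b @ [u, v] @ c) | i \<phi> v c. (i, \<phi>, v, c) \<in> \<Delta>})"
| weak: "saf_rule lt RWeak [(a, \<Gamma>)] (a, \<Gamma> \<union> \<Psi>)"


section \<open>Proof trees\<close>

text \<open>Nodes are addressed by the list of child indices on the way from the root \<open>[]\<close>, so ancestors
  are prefixes. The value of \<open>rule_at\<close> at a leaf is irrelevant.\<close>

record saf_tree =
  nodes :: "nat list set"
  sequent_at :: "nat list \<Rightarrow> sequent"
  rule_at :: "nat list \<Rightarrow> rule"

definition is_leaf :: "saf_tree \<Rightarrow> nat list \<Rightarrow> bool" where
  "is_leaf T p \<longleftrightarrow> p \<in> nodes T \<and> (\<forall>k. p @ [k] \<notin> nodes T)"

definition saf_proof :: "var_order \<Rightarrow> saf_tree \<Rightarrow> bool" where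
  "saf_proof lt T \<longleftrightarrow>
     [] \<in> nodes T \<and>
     (\<forall>p k. p @ [k] \<in> nodes T \<longrightarrow> p \<in> nodes T) \<and>
     (\<forall>p \<in> nodes T. is_sequent lt (sequent_at T p)) \<and>
     (\<forall>p \<in> nodes T. \<not> is_leaf T p \<longrightarrow>
        (\<exists>m. (\<forall>k. p @ [k] \<in> nodes T \<longleftrightarrow> k < m) \<and>
             saf_rule lt (rule_at T p) (map (\<lambda>k. sequent_at T (p @ [k])) [0..<m]) (sequent_at T p)))"

definition open_leaf :: "saf_tree \<Rightarrow> nat list \<Rightarrow> bool" where
  "open_leaf T l \<longleftrightarrow> is_leaf T l \<and> \<not> saf_axiom (sequent_at T l)"

definition back_edge_map :: "saf_tree \<Rightarrow> (nat list \<Rightarrow> nat list) \<Rightarrow> bool" where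
  "back_edge_map T f \<longleftrightarrow>
     (\<forall>l. open_leaf T l \<longrightarrow>
        f l \<in> nodes T \<and> \<not> is_leaf T (f l) \<and> prefix (f l) l \<and> sequent_at T (f l) = sequent_at T l)"

text \<open>The path from \<open>f l\<close> to \<open>l\<close> consists of the \<open>q\<close> with \<open>prefix (f l) q\<close> and \<open>prefix q l\<close>; the
  rule instances on it are those at its nodes other than the leaf \<open>l\<close>.\<close>

definition good_back_edge_map :: "saf_tree \<Rightarrow> (nat list \<Rightarrow> nat list) \<Rightarrow> bool" where
  "good_back_edge_map T f \<longleftrightarrow>
     back_edge_map T f \<and>
     (\<forall>l. open_leaf T l \<longrightarrow>
        (\<exists>u. (\<forall>q. prefix (f l) q \<and> prefix q l \<longrightarrow> u \<in> set (fst (sequent_at T q))) \<and>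
             (\<exists>q. prefix (f l) q \<and> strict_prefix q l \<and> rule_at T q = RReset u)))"

definition valid_saf_proof :: "var_order \<Rightarrow> saf_tree \<Rightarrow> bool" where
  "valid_saf_proof lt T \<longleftrightarrow>
     saf_proof lt T \<and> finite (nodes T) \<and> (\<exists>f. good_back_edge_map T f)"

text \<open>The order may or may not also relate variables that are not bound in \<open>\<phi>\<close>.\<close>

definition linearization :: "form \<Rightarrow> var_order \<Rightarrow> bool" where
  "linearization \<phi> lt \<longleftrightarrow> strict_linear_order_on (bv \<phi>) lt \<and> dep \<phi> \<subseteq> lt"

definition has_valid_saf_proof :: "form \<Rightarrow> bool" where
  "has_valid_saf_proof \<phi> \<longleftrightarrow>
     (\<exists>lt r T. linearization \<phi> lt \<and> r \<notin> noms \<phi> \<and>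
        valid_saf_proof lt T \<and> sequent_at T [] = ([], {(r, \<phi>, [])}))"

end

theory Submission
  imports Defs "HOL-Library.List_Lexorder"
begin

text \<open>Suppose that a model refutes the root. A refuted fixpoint formula \<open>\<nu>x.\<phi>\<close> already fails at some
  ordinal approximant, so a refuted formula has a signature: a tuple of ordinals, ordered
  lexicographically with the smaller variables first, which the unfolding of \<open>\<nu>x\<close> decreases in its part
  up to \<open>x\<close>. Interpret every name of \<open>x\<close> by an upper bound for that part of the signatures of the
  formulas it annotates, such that the bounds decrease strictly along the names of \<open>x\<close> in one
  annotation. A rule instance with refuted conclusion then has a refuted premise in which the bound of
  no name in the control has grown, and the bound of a name that is reset has become smaller. This
  gives an infinite run through the proof and its back-edges. Some name stays in the control from some
  point on and is reset infinitely often, so its bounds contain an infinite descent.\<close>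

section \<open>Approximants of greatest fixpoints\<close>

text \<open>Stages replace ordinals: sets of worlds, in an arbitrary well-order, serve merely as
  indices, with \<open>Infty\<close> on top. Taking sets rather than worlds makes the iteration long
  enough.\<close>

datatype 'w stage = Stage "'w set" | Infty

definition well_rel :: "'w set rel" where
  "well_rel = (SOME r. well_order_on UNIV r)"

lemma well_order_on_well_rel: "well_order_on UNIV well_rel"
  unfolding well_rel_def by (rule someI_ex[OF well_order_on])

instantiation stage :: (type) wellorder
begin

definition less_eq_stage :: "'a stage \<Rightarrow> 'a stage \<Rightarrow> bool" where
  "s \<le> t \<longleftrightarrow> (case t of Infty \<Rightarrow> True
     | Stage B \<Rightarrow> (case s of Infty \<Rightarrow> False | Stage A \<Rightarrow> (A, B) \<in> well_rel))"

definition less_stage :: "'a stage \<Rightarrow> 'a stage \<Rightarrow> bool" where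
  "(s::'a stage) < t \<longleftrightarrow> s \<le> t \<and> \<not> t \<le> s"

instance
proof
  have props: "refl well_rel" "trans well_rel" "antisym well_rel" "total well_rel"
    "wf (well_rel - Id :: 'a set rel)"
    using well_order_on_well_rel
    unfolding well_order_on_def linear_order_on_def partial_order_on_def preorder_on_def by auto
  fix s t u :: "'a stage"
  show "s < t \<longleftrightarrow> s \<le> t \<and> \<not> t \<le> s" by (rule less_stage_def)
  show "s \<le> s" using props(1) by (auto simp: less_eq_stage_def refl_on_def split: stage.split)
  show "s \<le> u" if "s \<le> t" "t \<le> u"
    using that props(2) by (auto simp: less_eq_stage_def split: stage.splits dest: transD)
  show "s = t" if "s \<le> t" "t \<le> s"
    using that props(3) by (auto simp: less_eq_stage_def split: stage.splits dest: antisymD)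
  show "s \<le> t \<or> t \<le> s"
    using props(1,4) unfolding less_eq_stage_def total_on_def refl_on_def
    by (metis (no_types, lifting) UNIV_I stage.case stage.exhaust)
  fix P :: "'a stage \<Rightarrow> bool" and a
  assume step: "\<And>s. (\<And>t. t < s \<Longrightarrow> P t) \<Longrightarrow> P s"
  have stage: "P (Stage A)" for A
    using props(5)
  proof (induction A rule: wf_induct_rule)
    case (less A)
    show ?case
    proof (rule step)
      fix t :: "'a stage" assume "t < Stage A"
      then obtain B where "t = Stage B" "(B, A) \<in> well_rel - Id"
        using props(1) unfolding less_stage_def less_eq_stage_def refl_on_def
        by (auto split: stage.splits)
      then show "P t" using less by blast
    qed
  qed
  have "P Infty"
  proof (rule step)
    fix t :: "'a stage" assume "t < Infty"
    then show "P t" using stage by (cases t) (auto simp: less_stage_def less_eq_stage_def)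
  qed
  with stage show "P a" by (cases a) auto
qed

end

lemma Stage_less_Infty: "Stage A < Infty"
  by (simp add: less_stage_def less_eq_stage_def)

text \<open>Intersecting over all smaller stages treats successors and limits alike, and makes the
  approximants decrease in \<open>s\<close> for every \<open>f\<close>.\<close>

function approx :: "'w set \<Rightarrow> ('w set \<Rightarrow> 'w set) \<Rightarrow> 'w stage \<Rightarrow> 'w set" where
  "approx W f s = {w \<in> W. \<forall>t<s. w \<in> f (approx W f t)}"
  by auto
termination
  by (relation "inv_image {(s, t). s < t} (\<lambda>(W, f, s). s)") (auto intro: wf)

declare approx.simps [simp del]

lemma approx_mono:
  assumes "\<And>X Y. X \<subseteq> Y \<Longrightarrow> f X \<subseteq> g Y"
  shows "approx W f s \<subseteq> approx W g s"
proof (induction s rule: less_induct)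
  case (less s)
  then show ?case
    unfolding approx.simps[of W f s] approx.simps[of W g s] using assms by blast
qed

text \<open>There are more stages below \<open>Infty\<close> than worlds, so the decreasing approximants cannot all
  be distinct.\<close>

lemma approx_Infty_subset: "approx W f Infty \<subseteq> \<Union>{X. X \<subseteq> W \<and> X \<subseteq> f X}"
proof -
  have "\<exists>A. approx W f (Stage A) \<subseteq> f (approx W f (Stage A))"
  proof (rule ccontr)
    assume "\<nexists>A. approx W f (Stage A) \<subseteq> f (approx W f (Stage A))"
    then have "\<forall>A. \<exists>w. w \<in> approx W f (Stage A) - f (approx W f (Stage A))" by blast
    then obtain g where g: "\<And>A. g A \<in> approx W f (Stage A) - f (approx W f (Stage A))" by metis
    \<comment> \<open>\<open>g B\<close> lies in \<open>f (approx W f (Stage A))\<close>, which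
      \<open>g A\<close> avoids by choice.\<close>
    have "g A \<noteq> g B" if "Stage A < Stage B" for A B
      using g[of A] g[of B] that approx.simps[of W f "Stage B"] by auto
    then have "inj g" unfolding inj_def by (metis neqE stage.inject)
    then have "inv g ` UNIV = Pow UNIV" using inj_imp_surj_inv by auto
    then show False using Cantors_theorem by blast
  qed
  then obtain A where A: "approx W f (Stage A) \<subseteq> f (approx W f (Stage A))" by blast
  have "approx W f Infty \<subseteq> approx W f (Stage A)"
    using Stage_less_Infty less_trans unfolding approx.simps[of W f Infty] approx.simps[of W f "Stage A"]
    by blast
  moreover have "approx W f (Stage A) \<subseteq> W" by (subst approx.simps) blast
  ultimately show ?thesis using A by blast
qed

section \<open>Signatures\<close>

definition trunc :: "nat \<Rightarrow> (nat \<Rightarrow> 'w stage) \<Rightarrow> nat \<Rightarrow> 'w stage" where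
  "trunc n \<sigma> = (\<lambda>k. if k < n then \<sigma> k else Infty)"

lemma trunc_below: "k < n \<Longrightarrow> trunc n \<sigma> k = \<sigma> k"
  by (simp add: trunc_def)

lemma trunc_trunc: "m \<le> n \<Longrightarrow> trunc m (trunc n \<sigma>) = trunc m \<sigma>"
  by (auto simp: trunc_def)

lemma trunc_upd: "k < n \<Longrightarrow> trunc n (\<sigma>(k := s)) = (trunc n \<sigma>)(k := s)"
  by (auto simp: trunc_def)

lemma trunc_upd_above: "n \<le> k \<Longrightarrow> trunc n (\<sigma>(k := s)) = trunc n \<sigma>"
  by (auto simp: trunc_def)

text \<open>Initial parts of signatures become lists in order to use the lexicographic order; the
  fixed length makes it well-founded.\<close>

definition pre :: "nat \<Rightarrow> (nat \<Rightarrow> 'w stage) \<Rightarrow> 'w stage list" where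
  "pre n \<sigma> = map \<sigma> [0..<n]"

lemma length_pre [simp]: "length (pre n \<sigma>) = n"
  by (simp add: pre_def)

lemma pre_cong: "(\<And>k. k < n \<Longrightarrow> \<sigma> k = \<tau> k) \<Longrightarrow> pre n \<sigma> = pre n \<tau>"
  by (simp add: pre_def)

lemma pre_less:
  assumes "k < n" "\<sigma> k < \<tau> k" "\<And>j. j < k \<Longrightarrow> \<sigma> j = \<tau> j"
  shows "pre n \<sigma> < pre n \<tau>"
proof -
  have "take k (pre n \<sigma>) = take k (pre n \<tau>)"
    using assms(1,3) by (intro nth_equalityI) (auto simp: pre_def)
  then show ?thesis
    unfolding list_less_def lexord_take_index_conv using assms(1,2)
    by (auto simp: pre_def intro!: exI[of _ k])
qed

text \<open>\<open>V\<close> will be the set of bound variables of the root formula and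
  \<open>B\<close> a strict bound on heights. Totality is confined to \<open>V\<close>, since a
  linearization guarantees no more.\<close>

locale fixpoint_order =
  fixes lt :: var_order and V :: "pvar set" and B :: nat
  assumes trans: "(x, y) \<in> lt \<Longrightarrow> (y, z) \<in> lt \<Longrightarrow> (x, z) \<in> lt"
    and irrefl: "(x, x) \<notin> lt"
    and total: "x \<in> V \<Longrightarrow> y \<in> V \<Longrightarrow> x \<noteq> y \<Longrightarrow> (x, y) \<in> lt \<or> (y, x) \<in> lt"
    and finite_V: "finite V"
begin

lemma asym: "(x, y) \<in> lt \<Longrightarrow> (y, x) \<notin> lt"
  using trans irrefl by blast

text \<open>A variable may be rebound below its own binder. The height of \<open>x\<close> counts the nested binders
  of \<open>x\<close> that can be reached without unfolding a smaller variable; cut off in this way it is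
  invariant under unfolding.\<close>

primrec ht :: "pvar \<Rightarrow> form \<Rightarrow> nat" where
  "ht x (Prop p) = 0"
| "ht x (NProp p) = 0"
| "ht x (Nom i) = 0"
| "ht x (NNom i) = 0"
| "ht x (Or \<phi> \<psi>) = max (ht x \<phi>) (ht x \<psi>)"
| "ht x (And \<phi> \<psi>) = max (ht x \<phi>) (ht x \<psi>)"
| "ht x (Dia \<phi>) = ht x \<phi>"
| "ht x (Box \<phi>) = ht x \<phi>"
| "ht x (At i \<phi>) = ht x \<phi>"
| "ht x (Fix \<eta> y \<phi>) =
     (if y = x then Suc (ht x \<phi>) else if (y, x) \<in> lt then 0 else ht x \<phi>)"

definition idx :: "pvar \<Rightarrow> nat" where
  "idx x = card {z \<in> V. (z, x) \<in> lt}"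

text \<open>A signature lists stages by decreasing significance: smaller variables come first and, for
  the same variable, binders of larger height. The positions below \<open>lim x\<close> are those of the
  variables up to \<open>x\<close>.\<close>

definition key :: "pvar \<Rightarrow> nat \<Rightarrow> nat" where
  "key x h = idx x * B + (B - Suc h)"

definition lim :: "pvar \<Rightarrow> nat" where
  "lim x = Suc (idx x) * B"

lemma key_less_lim: "h < B \<Longrightarrow> key x h < lim x"
  unfolding key_def lim_def by auto

lemma key_eqD: "key x h = key x h' \<Longrightarrow> h < B \<Longrightarrow> h' < B \<Longrightarrow> h = h'"
  unfolding key_def by linarith

lemma lim_mono:
  assumes "(x, y) \<in> lt" "x \<in> V"
  shows "lim x \<le> idx y * B"
proof -
  have "{z \<in> V. (z, x) \<in> lt} \<subset> {z \<in> V. (z, y) \<in> lt}"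
    using assms trans irrefl by blast
  then have "idx x < idx y"
    unfolding idx_def by (rule psubset_card_mono[rotated]) (simp add: finite_V)
  then have "Suc (idx x) \<le> idx y" by simp
  then show ?thesis unfolding lim_def by (rule mult_le_mono1)
qed

lemma lim_le_key: "(x, y) \<in> lt \<Longrightarrow> x \<in> V \<Longrightarrow> lim x \<le> key y h"
  unfolding key_def using lim_mono trans_le_add1 by blast

lemma lim_le_lim: "(x, y) \<in> lt \<Longrightarrow> x \<in> V \<Longrightarrow> lim x \<le> lim y"
  using lim_mono[of x y] unfolding lim_def[of y] by simp

text \<open>The invariant of the formulas in a run. Unlike \<open>formula\<close>, it refers to the
  fixed order, variables and height bound; its last clause says that dependencies follow
  \<open>lt\<close>.\<close>

primrec ok :: "form \<Rightarrow> bool" where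
  "ok (Prop p) = True"
| "ok (NProp p) = True"
| "ok (Nom i) = True"
| "ok (NNom i) = True"
| "ok (Or \<phi> \<psi>) = (ok \<phi> \<and> ok \<psi>)"
| "ok (And \<phi> \<psi>) = (ok \<phi> \<and> ok \<psi>)"
| "ok (Dia \<phi>) = ok \<phi>"
| "ok (Box \<phi>) = ok \<phi>"
| "ok (At i \<phi>) = ok \<phi>"
| "ok (Fix \<eta> x \<phi>) = (ok \<phi> \<and> x \<in> V \<and> ht x \<phi> < B \<and> x \<notin> neg_fv \<phi> \<and>
     (\<forall>z \<in> fv \<phi> - {x}. z \<in> V \<longrightarrow> (z, x) \<in> lt))"

text \<open>Below a binder of \<open>x\<close> the stages of larger variables are forgotten: an unfolding of \<open>x\<close> may
  restart them, and no name of such a variable survives it.\<close>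

primrec semS :: "(nat \<Rightarrow> 'w stage) \<Rightarrow> form \<Rightarrow> 'w kripke \<Rightarrow> 'w set" where
  "semS \<sigma> (Prop p) M = val M p"
| "semS \<sigma> (NProp p) M = worlds M - val M p"
| "semS \<sigma> (Nom i) M = {assign M i}"
| "semS \<sigma> (NNom i) M = worlds M - {assign M i}"
| "semS \<sigma> (Or \<phi> \<psi>) M = semS \<sigma> \<phi> M \<union> semS \<sigma> \<psi> M"
| "semS \<sigma> (And \<phi> \<psi>) M = semS \<sigma> \<phi> M \<inter> semS \<sigma> \<psi> M"
| "semS \<sigma> (Dia \<phi>) M = {w \<in> worlds M. \<exists>v. (w, v) \<in> acc M \<and> v \<in> semS \<sigma> \<phi> M}"
| "semS \<sigma> (Box \<phi>) M = {w \<in> worlds M. \<forall>v. (w, v) \<in> acc M \<longrightarrow> v \<in> semS \<sigma> \<phi> M}"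
| "semS \<sigma> (At i \<phi>) M = {w \<in> worlds M. assign M i \<in> semS \<sigma> \<phi> M}"
| "semS \<sigma> (Fix \<eta> x \<phi>) M =
     (let f = (\<lambda>X. semS (trunc (lim x) \<sigma>) \<phi> (M\<lparr>val := (val M)(x := X)\<rparr>)) in
      case \<eta> of
        Mu \<Rightarrow> \<Inter>{X. X \<subseteq> worlds M \<and> f X \<subseteq> X}
      | Nu \<Rightarrow> approx (worlds M) f (\<sigma> (key x (ht x \<phi>))))"

section \<open>Basic properties of the semantics with signatures\<close>

lemma semS_Infty: "semS (\<lambda>_. Infty) \<phi> M \<subseteq> sem \<phi> M"
proof (induction \<phi> arbitrary: M)
  case (Fix \<eta> x \<phi>)
  let ?f = "\<lambda>X. semS (\<lambda>_. Infty) \<phi> (M\<lparr>val := (val M)(x := X)\<rparr>)"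
  let ?g = "\<lambda>X. sem \<phi> (M\<lparr>val := (val M)(x := X)\<rparr>)"
  have eq: "trunc (lim x) (\<lambda>_. Infty) = (\<lambda>_. Infty)" by (auto simp: trunc_def)
  have sub: "?f X \<subseteq> ?g X" for X by (rule Fix)
  show ?case
  proof (cases \<eta>)
    case Mu
    have "\<Inter>{X. X \<subseteq> worlds M \<and> ?f X \<subseteq> X} \<subseteq> \<Inter>{X. X \<subseteq> worlds M \<and> ?g X \<subseteq> X}"
      using sub by (intro Inter_anti_mono) blast
    then show ?thesis by (simp add: Mu eq)
  next
    case Nu
    have "\<Union>{X. X \<subseteq> worlds M \<and> X \<subseteq> ?f X} \<subseteq> \<Union>{X. X \<subseteq> worlds M \<and> X \<subseteq> ?g X}"
      using sub by (intro Union_mono) blast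
    then show ?thesis using approx_Infty_subset[of "worlds M" ?f] by (simp add: Nu eq)
  qed
qed (simp; blast)+

text \<open>Two valuations vary at once because a binder may assign different sets to its variable
  on the two sides; positivity keeps that variable out of the last hypothesis.\<close>

lemma semS_mono:
  assumes "ok \<phi>" "\<And>p. v p \<subseteq> v' p" "\<And>p. p \<in> neg_fv \<phi> \<Longrightarrow> v p = v' p"
  shows "semS \<sigma> \<phi> (M\<lparr>val := v\<rparr>) \<subseteq> semS \<sigma> \<phi> (M\<lparr>val := v'\<rparr>)"
  using assms
proof (induction \<phi> arbitrary: \<sigma> v v')
  case (Fix \<eta> x \<phi>)
  let ?f = "\<lambda>v X. semS (trunc (lim x) \<sigma>) \<phi> (M\<lparr>val := v(x := X)\<rparr>)"
  have step: "?f v X \<subseteq> ?f v' Y" if "X \<subseteq> Y" for X Y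
    by (rule Fix.IH) (use Fix.prems that in auto)
  show ?case
  proof (cases \<eta>)
    case Mu
    have "\<Inter>{X. X \<subseteq> worlds M \<and> ?f v X \<subseteq> X} \<subseteq> \<Inter>{X. X \<subseteq> worlds M \<and> ?f v' X \<subseteq> X}"
      by (rule Inter_anti_mono) (use step[OF subset_refl] in blast)
    then show ?thesis by (simp add: Mu)
  next
    case Nu
    then show ?thesis using approx_mono[of "?f v" "?f v'", OF step] by (simp add: Let_def)
  qed
next
  case (Or \<phi> \<psi>)
  have "semS \<sigma> \<phi> (M\<lparr>val := v\<rparr>) \<subseteq> semS \<sigma> \<phi> (M\<lparr>val := v'\<rparr>)"
    "semS \<sigma> \<psi> (M\<lparr>val := v\<rparr>) \<subseteq> semS \<sigma> \<psi> (M\<lparr>val := v'\<rparr>)"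
    by (rule Or.IH; use Or.prems in simp)+
  then show ?case by auto
next
  case (And \<phi> \<psi>)
  have "semS \<sigma> \<phi> (M\<lparr>val := v\<rparr>) \<subseteq> semS \<sigma> \<phi> (M\<lparr>val := v'\<rparr>)"
    "semS \<sigma> \<psi> (M\<lparr>val := v\<rparr>) \<subseteq> semS \<sigma> \<psi> (M\<lparr>val := v'\<rparr>)"
    by (rule And.IH; use And.prems in simp)+
  then show ?case by auto
next
  case (Dia \<phi>)
  have "semS \<sigma> \<phi> (M\<lparr>val := v\<rparr>) \<subseteq> semS \<sigma> \<phi> (M\<lparr>val := v'\<rparr>)"
    by (rule Dia.IH; use Dia.prems in simp)
  then show ?case by auto
next
  case (Box \<phi>)
  have "semS \<sigma> \<phi> (M\<lparr>val := v\<rparr>) \<subseteq> semS \<sigma> \<phi> (M\<lparr>val := v'\<rparr>)"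
    by (rule Box.IH; use Box.prems in simp)
  then show ?case by auto
next
  case (At i \<phi>)
  have "semS \<sigma> \<phi> (M\<lparr>val := v\<rparr>) \<subseteq> semS \<sigma> \<phi> (M\<lparr>val := v'\<rparr>)"
    by (rule At.IH; use At.prems in simp)
  then show ?case by auto
qed auto

lemma semS_mono_var:
  assumes "ok \<phi>" "x \<notin> neg_fv \<phi>" "X \<subseteq> Y"
  shows "semS \<sigma> \<phi> (M\<lparr>val := (val M)(x := X)\<rparr>) \<subseteq> semS \<sigma> \<phi> (M\<lparr>val := (val M)(x := Y)\<rparr>)"
  by (rule semS_mono) (use assms in auto)

lemma semS_cong:
  assumes "\<And>p. p \<in> fv \<phi> \<Longrightarrow> val M p = val M' p" "\<And>i. i \<in> noms \<phi> \<Longrightarrow> assign M i = assign M' i"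
    "worlds M = worlds M'" "acc M = acc M'"
  shows "semS \<sigma> \<phi> M = semS \<sigma> \<phi> M'"
  using assms
proof (induction \<phi> arbitrary: \<sigma> M M')
  case (Fix \<eta> x \<phi>)
  have "semS (trunc (lim x) \<sigma>) \<phi> (M\<lparr>val := (val M)(x := X)\<rparr>) =
    semS (trunc (lim x) \<sigma>) \<phi> (M'\<lparr>val := (val M')(x := X)\<rparr>)" for X
    using Fix.prems by (intro Fix.IH) auto
  then show ?case using Fix.prems by (cases \<eta>) simp_all
next
  case (Or \<phi> \<psi>)
  have "semS \<sigma> \<phi> M = semS \<sigma> \<phi> M'" "semS \<sigma> \<psi> M = semS \<sigma> \<psi> M'"
    by (rule Or.IH; use Or.prems in auto)+
  then show ?case by simp
next
  case (And \<phi> \<psi>)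
  have "semS \<sigma> \<phi> M = semS \<sigma> \<phi> M'" "semS \<sigma> \<psi> M = semS \<sigma> \<psi> M'"
    by (rule And.IH; use And.prems in auto)+
  then show ?case by simp
next
  case (Dia \<phi>)
  have "semS \<sigma> \<phi> M = semS \<sigma> \<phi> M'" by (rule Dia.IH; use Dia.prems in auto)
  then show ?case using Dia.prems by simp
next
  case (Box \<phi>)
  have "semS \<sigma> \<phi> M = semS \<sigma> \<phi> M'" by (rule Box.IH; use Box.prems in auto)
  then show ?case using Box.prems by simp
next
  case (At i \<phi>)
  have "semS \<sigma> \<phi> M = semS \<sigma> \<phi> M'" by (rule At.IH; use At.prems in auto)
  then show ?case using At.prems by simp
qed auto

text \<open>A binder of \<open>x\<close> counted by the height reads a position of height below
  \<open>ht x \<phi>\<close>, hence not the changed one. The uncounted ones lie below a binder of a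
  smaller variable, where truncation erases the changed position.\<close>

lemma semS_upd:
  assumes "ok \<phi>" "x \<in> V" "ht x \<phi> \<le> h" "h < B"
  shows "semS (\<sigma>(key x h := s)) \<phi> M = semS \<sigma> \<phi> M"
  using assms
proof (induction \<phi> arbitrary: \<sigma> M)
  case (Fix \<eta> y \<phi>)
  let ?k = "key x h" and ?k' = "key y (ht y \<phi>)"
  have y: "y \<in> V" "ht y \<phi> < B" using Fix.prems by auto
  consider "y = x" | "(y, x) \<in> lt" | "(x, y) \<in> lt" using total y(1) Fix.prems(2) by blast
  then have "?k' \<noteq> ?k \<and> (\<forall>M. semS (trunc (lim y) (\<sigma>(?k := s))) \<phi> M = semS (trunc (lim y) \<sigma>) \<phi> M)"
  proof cases
    case 1
    then have "?k < lim y" "?k' \<noteq> ?k"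
      using Fix.prems key_less_lim key_eqD[of y "ht y \<phi>" h] by auto
    moreover have "semS (\<tau>(?k := s)) \<phi> N = semS \<tau> \<phi> N" for \<tau> N
      by (rule Fix.IH) (use Fix.prems 1 in auto)
    ultimately show ?thesis by (simp only: trunc_upd) simp
  next
    case 2
    then have "lim y \<le> ?k" "?k' < ?k"
      using lim_le_key[of y x h] key_less_lim[of "ht y \<phi>" y] y by auto
    then show ?thesis by (simp add: trunc_upd_above)
  next
    case 3
    then have "lim x \<le> ?k'" "lim x \<le> lim y" "?k < lim x"
      using lim_le_key lim_le_lim key_less_lim Fix.prems by auto
    then have "?k < ?k'" "?k < lim y" by auto
    moreover have "semS (\<tau>(?k := s)) \<phi> N = semS \<tau> \<phi> N" for \<tau> N
      by (rule Fix.IH) (use Fix.prems 3 asym irrefl in \<open>auto split: if_splits\<close>)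
    ultimately show ?thesis by (simp only: trunc_upd) simp
  qed
  then have ne: "?k' \<noteq> ?k"
    and eq: "semS (trunc (lim y) (\<sigma>(?k := s))) \<phi> N = semS (trunc (lim y) \<sigma>) \<phi> N" for N
    by auto
  show ?case by (simp only: semS.simps Let_def eq fun_upd_other[OF ne])
qed auto

lemma semS_trunc: "ok (Fix \<eta> x \<phi>) \<Longrightarrow> semS (trunc (lim x) \<sigma>) (Fix \<eta> x \<phi>) M = semS \<sigma> (Fix \<eta> x \<phi>) M"
  by (cases \<eta>) (simp_all add: trunc_trunc trunc_below key_less_lim)

section \<open>Substitution of fixpoint formulas\<close>

lemma subst_notin_fv: "x \<notin> fv \<phi> \<Longrightarrow> subst \<phi> x \<theta> = \<phi>"
  by (induction \<phi>) auto

lemma neg_fv_subset: "neg_fv \<phi> \<subseteq> fv \<phi>"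
  by (induction \<phi>) auto

lemma fv_subst: "fv (subst \<phi> x \<theta>) \<subseteq> fv \<phi> \<union> fv \<theta>"
  by (induction \<phi>) (auto split: if_splits)

lemma neg_fv_subst: "neg_fv (subst \<phi> x \<theta>) \<subseteq> neg_fv \<phi> \<union> neg_fv \<theta>"
  by (induction \<phi>) (auto split: if_splits)

text \<open>Here the cut-off in \<open>ht\<close> pays: since \<open>x\<close> is smaller than
  \<open>y\<close>, the inserted formula has height 0 for \<open>y\<close>, like the variable it
  replaces.\<close>

lemma ht_subst: "(x, y) \<in> lt \<Longrightarrow> ht y (subst \<phi> x (Fix \<eta> x \<psi>)) = ht y \<phi>"
  using irrefl by (induction \<phi>) auto

text \<open>If \<open>x\<close> is free in a binder of \<open>y\<close>, then \<open>x\<close> is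
  smaller than \<open>y\<close>; the free variables of the inserted formula that lie in
  \<open>V\<close> are below \<open>x\<close>, hence below \<open>y\<close>. So nothing is captured
  and the order condition survives.\<close>

lemma ok_subst:
  assumes "ok \<phi>" "ok (Fix \<eta> x \<psi>)" "x \<notin> neg_fv \<phi>"
  shows "ok (subst \<phi> x (Fix \<eta> x \<psi>))"
  using assms(1,3)
proof (induction \<phi>)
  case (Fix \<eta>' y \<phi>)
  show ?case
  proof (cases "x \<in> fv (Fix \<eta>' y \<phi>)")
    case False
    then show ?thesis using Fix subst_notin_fv by metis
  next
    case True
    then have xy: "(x, y) \<in> lt" "y \<noteq> x" "x \<in> fv \<phi>" using Fix.prems assms(2) by auto
    have fv: "z \<in> V \<Longrightarrow> z \<in> fv \<psi> - {x} \<Longrightarrow> (z, y) \<in> lt" for z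
      using assms(2) xy trans by auto
    then have "y \<notin> fv (Fix \<eta> x \<psi>)" using irrefl Fix.prems by auto
    then have "y \<notin> neg_fv (subst \<phi> x (Fix \<eta> x \<psi>))"
      using Fix.prems neg_fv_subst[of \<phi> x "Fix \<eta> x \<psi>"] neg_fv_subset[of "Fix \<eta> x \<psi>"] by auto
    moreover have "(z, y) \<in> lt" if "z \<in> V" "z \<in> fv (subst \<phi> x (Fix \<eta> x \<psi>))" "z \<noteq> y" for z
      using that fv[of z] fv_subst[of \<phi> x "Fix \<eta> x \<psi>"] Fix.prems(1) by auto
    ultimately show ?thesis using Fix xy by (simp add: ht_subst)
  qed
qed (use assms in auto)

lemma semS_subst:
  assumes "ok \<phi>" "ok (Fix \<eta> x \<psi>)" "x \<notin> neg_fv \<phi>"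
  shows "semS \<sigma> (subst \<phi> x (Fix \<eta> x \<psi>)) M =
    semS \<sigma> \<phi> (M\<lparr>val := (val M)(x := semS \<sigma> (Fix \<eta> x \<psi>) M)\<rparr>)"
  using assms(1,3)
proof (induction \<phi> arbitrary: \<sigma> M)
  case (Fix \<eta>' y \<phi>)
  let ?\<theta> = "Fix \<eta> x \<psi>"
  let ?M = "M\<lparr>val := (val M)(x := semS \<sigma> ?\<theta> M)\<rparr>"
  show ?case
  proof (cases "x \<in> fv (Fix \<eta>' y \<phi>)")
    case False
    then have "semS \<sigma> (Fix \<eta>' y \<phi>) ?M = semS \<sigma> (Fix \<eta>' y \<phi>) M" by (intro semS_cong) auto
    then show ?thesis using False subst_notin_fv by metis
  next
    case True
    then have xy: "(x, y) \<in> lt" "y \<noteq> x" using Fix.prems assms(2) by auto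
    have "y \<notin> fv ?\<theta>" using xy assms(2) Fix.prems asym by auto
    then have "semS (trunc (lim y) \<sigma>) ?\<theta> (M\<lparr>val := (val M)(y := X)\<rparr>) = semS (trunc (lim y) \<sigma>) ?\<theta> M" for X
      by (intro semS_cong) auto
    \<comment> \<open>Truncation at the larger variable \<open>y\<close> is invisible to
      \<open>?\<theta>\<close>, which reads only positions below \<open>lim x\<close>.\<close>
    moreover have "semS (trunc (lim y) \<sigma>) ?\<theta> M = semS \<sigma> ?\<theta> M"
      using semS_trunc[OF assms(2)] trunc_trunc[OF lim_le_lim[OF xy(1)]] assms(2) by (metis ok.simps(10))
    ultimately have eq: "semS (trunc (lim y) \<sigma>) ?\<theta> (M\<lparr>val := (val M)(y := X)\<rparr>) = semS \<sigma> ?\<theta> M" for X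
      by (simp only:)
    have "semS (trunc (lim y) \<sigma>) (subst \<phi> x ?\<theta>) (M\<lparr>val := (val M)(y := X)\<rparr>)
      = semS (trunc (lim y) \<sigma>) \<phi> (?M\<lparr>val := (val ?M)(y := X)\<rparr>)" for X
    proof -
      have "semS (trunc (lim y) \<sigma>) (subst \<phi> x ?\<theta>) (M\<lparr>val := (val M)(y := X)\<rparr>)
        = semS (trunc (lim y) \<sigma>) \<phi> (M\<lparr>val := (val M)(y := X, x := semS \<sigma> ?\<theta> M)\<rparr>)"
        using Fix.IH[of "trunc (lim y) \<sigma>" "M\<lparr>val := (val M)(y := X)\<rparr>"] Fix.prems xy(2)
        by (simp add: eq del: semS.simps fun_upd_apply)
      then show ?thesis using xy(2) by (simp add: fun_upd_twist del: semS.simps fun_upd_apply)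
    qed
    then show ?thesis using xy by (cases \<eta>') (simp_all add: ht_subst semS.simps(10)[of _ _ y] del: semS.simps(10) fun_upd_apply)
  qed
qed (auto simp del: semS.simps(10))

end

section \<open>Local soundness\<close>

lemma sorted_wrt_subseq: "subseq xs ys \<Longrightarrow> sorted_wrt P ys \<Longrightarrow> sorted_wrt P xs"
  by (induction rule: list_emb.induct) (auto dest: subseq_set_subset)

context fixpoint_order
begin

text \<open>The new signature is truncated at \<open>lim x\<close>, which is what the body sees
  anyway. For \<open>Nu\<close>, failing at a stage means failing \<open>?f\<close> of an earlier
  approximant, whose stage becomes the new entry of \<open>x\<close>.\<close>

lemma unfold_refuted:
  assumes ok: "ok (Fix \<eta> x \<phi>)" and w: "w \<in> worlds M" "w \<notin> semS \<sigma> (Fix \<eta> x \<phi>) M"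
  shows "\<exists>\<sigma>'. w \<notin> semS \<sigma>' (unfold_fix \<eta> x \<phi>) M \<and> pre (lim x) \<sigma>' \<le> pre (lim x) \<sigma> \<and>
    (\<eta> = Nu \<longrightarrow> pre (lim x) \<sigma>' < pre (lim x) \<sigma>) \<and>
    (\<forall>y\<in>V. (y, x) \<in> lt \<longrightarrow> pre (lim y) \<sigma>' = pre (lim y) \<sigma>)"
proof -
  let ?\<theta> = "Fix \<eta> x \<phi>" and ?\<tau> = "trunc (lim x) \<sigma>" and ?k = "key x (ht x \<phi>)"
  let ?f = "\<lambda>X. semS ?\<tau> \<phi> (M\<lparr>val := (val M)(x := X)\<rparr>)"
  have props: "ok \<phi>" "x \<in> V" "x \<notin> neg_fv \<phi>" "ht x \<phi> < B" using ok by auto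
  have unfold: "semS \<sigma>' (unfold_fix \<eta> x \<phi>) M =
      semS \<sigma>' \<phi> (M\<lparr>val := (val M)(x := semS \<sigma>' ?\<theta> M)\<rparr>)" for \<sigma>' :: "nat \<Rightarrow> 'a stage"
    unfolding unfold_fix_def using props ok by (intro semS_subst)
  have lim: "lim y \<le> lim x" if "y \<in> V" "(y, x) \<in> lt" for y using that lim_le_lim by blast
  have agree: "pre n ?\<tau> = pre n \<sigma>" if "n \<le> lim x" for n
    using that by (intro pre_cong) (simp add: trunc_below)
  show ?thesis
  proof (cases \<eta>)
    case Mu
    define S where "S = {X. X \<subseteq> worlds M \<and> ?f X \<subseteq> X}"
    let ?L = "\<Inter>S"
    have L: "semS \<sigma> ?\<theta> M = ?L" by (simp add: Mu S_def)
    obtain X where S: "X \<in> S" and X: "w \<notin> X" using w(2) unfolding L by blast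
    have "?f X \<subseteq> X" using S unfolding S_def by simp
    moreover have "?f ?L \<subseteq> ?f X" using props Inter_lower[OF S] by (intro semS_mono_var)
    ultimately have "w \<notin> ?f ?L" using X by (meson subsetD)
    moreover have "semS ?\<tau> (unfold_fix \<eta> x \<phi>) M = ?f ?L"
      by (simp only: unfold semS_trunc[OF ok] L)
    ultimately have "w \<notin> semS ?\<tau> (unfold_fix \<eta> x \<phi>) M" by (simp only: not_False_eq_True)
    then show ?thesis using agree lim Mu by (intro exI[of _ ?\<tau>]) auto
  next
    case Nu
    have "w \<notin> approx (worlds M) ?f (\<sigma> ?k)" using w(2) by (simp add: Nu)
    then obtain t where t: "t < \<sigma> ?k" "w \<notin> ?f (approx (worlds M) ?f t)"
      unfolding approx.simps[of _ _ "\<sigma> ?k"] using w(1) by blast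
    let ?\<sigma>' = "?\<tau>(?k := t)"
    have k: "?k < lim x" using props(4) by (rule key_less_lim)
    \<comment> \<open>The changed entry belongs to the height of this very binder and is not read by
      the body, so only the fixpoint itself moves to stage \<open>t\<close>.\<close>
    have upd: "semS ?\<sigma>' \<phi> N = semS ?\<tau> \<phi> N" for N
      using props by (intro semS_upd) auto
    have "trunc (lim x) ?\<sigma>' = ?\<sigma>'" using k by (simp add: trunc_upd trunc_trunc)
    then have "semS ?\<sigma>' ?\<theta> M = approx (worlds M) ?f t"
      by (simp add: Nu upd del: fun_upd_apply) simp
    then have "w \<notin> semS ?\<sigma>' (unfold_fix \<eta> x \<phi>) M"
      unfolding unfold upd using t(2) by simp
    moreover have "pre (lim x) ?\<sigma>' < pre (lim x) \<sigma>"
      using k t(1) by (intro pre_less[of ?k]) (auto simp: trunc_below)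
    moreover have "pre (lim y) ?\<sigma>' = pre (lim y) \<sigma>" if "y \<in> V" "(y, x) \<in> lt" for y
      using that lim[OF that] lim_le_key[of y x "ht x \<phi>"]
      by (intro pre_cong) (auto simp: trunc_below)
    ultimately show ?thesis by (intro exI[of _ ?\<sigma>']) (auto intro: less_imp_le)
  qed
qed

lemma ok_unfold: "ok (Fix \<eta> x \<phi>) \<Longrightarrow> ok (unfold_fix \<eta> x \<phi>)"
  unfolding unfold_fix_def by (intro ok_subst) auto

text \<open>A name \<open>u\<close> of \<open>x\<close> is interpreted as an upper bound \<open>d u\<close> for the part of the signature that
  belongs to the variables up to \<open>x\<close>. Consecutive names of the same variable record successive
  unfoldings, hence the strict descent.\<close>

definition entry :: "(name \<Rightarrow> 'w stage list) \<Rightarrow> 'w kripke \<Rightarrow> aform \<Rightarrow> bool" where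
  "entry d M = (\<lambda>(i, \<phi>, b). ok \<phi> \<and> fst ` set b \<subseteq> V \<and>
     sorted_wrt (\<lambda>u v. fst u = fst v \<longrightarrow> d v < d u) b \<and>
     (\<exists>\<sigma>. assign M i \<notin> semS \<sigma> \<phi> M \<and> (\<forall>u\<in>set b. pre (lim (fst u)) \<sigma> \<le> d u)))"

text \<open>The fixed length of every bound excludes infinite descent in the lexicographic order.
  The model is a parameter because a modal step reinterprets a nominal.\<close>

definition refuted :: "(name \<Rightarrow> 'w stage list) \<Rightarrow> 'w kripke \<Rightarrow> aform set \<Rightarrow> bool" where
  "refuted d M \<Gamma> \<longleftrightarrow> kripke_model M \<and> (\<forall>u. length (d u) = lim (fst u)) \<and> (\<forall>e\<in>\<Gamma>. entry d M e)"

text \<open>For rules that copy the annotation: the signature is kept, so all bounds stay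
  correct.\<close>

lemma entry_propagate:
  assumes "entry d M (i, \<phi>, b)" "ok \<phi> \<Longrightarrow> ok \<psi>"
    and "\<And>\<sigma>. assign M i \<notin> semS \<sigma> \<phi> M \<Longrightarrow> assign M' j \<notin> semS \<sigma> \<psi> M'"
  shows "entry d M' (j, \<psi>, b)"
  using assms unfolding entry_def by auto

lemma entry_subseq: "entry d M (i, \<phi>, b') \<Longrightarrow> subseq b b' \<Longrightarrow> entry d M (i, \<phi>, b)"
  using subseq_set_subset[of b b'] unfolding entry_def by (fastforce intro: sorted_wrt_subseq)

lemma sorted_wrt_update:
  assumes "u \<notin> set b"
  shows "sorted_wrt (\<lambda>v w. fst v = fst w \<longrightarrow> (d(u := l)) w < (d(u := l)) v) b \<longleftrightarrow>
    sorted_wrt (\<lambda>v w. fst v = fst w \<longrightarrow> d w < d v) b"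
  using assms by (induction b) auto

lemma sorted_wrt_snoc_update:
  assumes "u \<notin> set b" "sorted_wrt (\<lambda>v w. fst v = fst w \<longrightarrow> d w < d v) b"
    and "\<And>v. v \<in> set b \<Longrightarrow> fst v = fst u \<Longrightarrow> l < d v"
  shows "sorted_wrt (\<lambda>v w. fst v = fst w \<longrightarrow> (d(u := l)) w < (d(u := l)) v) (b @ [u])"
  using assms by (induction b) auto

lemma entry_update:
  assumes "entry d M (i, \<phi>, b)" "u \<notin> set b"
  shows "entry (d(u := l)) M (i, \<phi>, b)"
  using assms sorted_wrt_update[OF assms(2), of d l] unfolding entry_def by auto

text \<open>The second part serves \<open>RRec\<close>: the new name is bounded by the decreased
  signature, which lies strictly below the bounds of all earlier names of \<open>x\<close>.\<close>

lemma entry_unfold: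
  assumes e: "entry d M (i, Fix \<eta> x \<phi>, b)" and b: "word_le_var lt b x" and M: "kripke_model M"
  shows "entry d M (i, unfold_fix \<eta> x \<phi>, b)"
    and "\<eta> = Nu \<Longrightarrow> u \<notin> set b \<Longrightarrow> fst u = x \<Longrightarrow>
      \<exists>l. length l = lim x \<and> entry (d(u := l)) M (i, unfold_fix \<eta> x \<phi>, b @ [u])"
proof -
  obtain \<sigma> where ok: "ok (Fix \<eta> x \<phi>)" and V: "fst ` set b \<subseteq> V"
    and desc: "sorted_wrt (\<lambda>u v. fst u = fst v \<longrightarrow> d v < d u) b"
    and \<sigma>: "assign M i \<notin> semS \<sigma> (Fix \<eta> x \<phi>) M" "\<forall>u\<in>set b. pre (lim (fst u)) \<sigma> \<le> d u"
    using e unfolding entry_def by auto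
  have "assign M i \<in> worlds M" using M unfolding kripke_model_def by blast
  then obtain \<sigma>' where \<sigma>': "assign M i \<notin> semS \<sigma>' (unfold_fix \<eta> x \<phi>) M"
    "pre (lim x) \<sigma>' \<le> pre (lim x) \<sigma>" "\<eta> = Nu \<longrightarrow> pre (lim x) \<sigma>' < pre (lim x) \<sigma>"
    "\<forall>y\<in>V. (y, x) \<in> lt \<longrightarrow> pre (lim y) \<sigma>' = pre (lim y) \<sigma>"
    using unfold_refuted[OF ok _ \<sigma>(1)] by blast
  have x: "x \<in> V" using ok by simp
  have le: "pre (lim (fst v)) \<sigma>' \<le> d v" if "v \<in> set b" for v
  proof -
    \<comment> \<open>The side condition leaves no name of a larger variable, on whose positions the
      new signature is not controlled.\<close>
    have "fst v = x \<or> (fst v, x) \<in> lt"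
      using that b V x total unfolding word_le_var_def by blast
    then have "pre (lim (fst v)) \<sigma>' \<le> pre (lim (fst v)) \<sigma>"
      using \<sigma>'(2,4) V that by auto
    then show ?thesis using \<sigma>(2) that by (meson order_trans)
  qed
  show "entry d M (i, unfold_fix \<eta> x \<phi>, b)"
    using ok_unfold[OF ok] V desc \<sigma>'(1) le unfolding entry_def by blast
  assume u: "\<eta> = Nu" "u \<notin> set b" "fst u = x"
  let ?d = "d(u := pre (lim x) \<sigma>')"
  have "pre (lim x) \<sigma>' < d v" if "v \<in> set b" "fst v = x" for v
    using \<sigma>(2) \<sigma>'(3) u(1) that by (metis less_le_trans)
  then have "sorted_wrt (\<lambda>u v. fst u = fst v \<longrightarrow> ?d v < ?d u) (b @ [u])"
    using sorted_wrt_snoc_update[OF u(2) desc] u(3) by blast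
  then have "entry ?d M (i, unfold_fix \<eta> x \<phi>, b @ [u])"
    using ok_unfold[OF ok] V x u \<sigma>'(1) le unfolding entry_def by auto
  then show "\<exists>l. length l = lim x \<and> entry (d(u := l)) M (i, unfold_fix \<eta> x \<phi>, b @ [u])"
    by (metis length_pre)
qed

lemma assign_update:
  assumes "j \<notin> insert i (noms \<phi>)"
  shows "assign (M\<lparr>assign := (assign M)(j := v)\<rparr>) i = assign M i"
    and "semS \<sigma> \<phi> (M\<lparr>assign := (assign M)(j := v)\<rparr>) = semS \<sigma> \<phi> M"
  by (use assms in simp) (rule semS_cong; use assms in auto)

lemma refuted_modal:
  assumes fresh: "j \<notin> seq_noms (\<Gamma> \<union> {(i, Box \<phi>, b)} \<union> {(i, Dia \<psi>, c) | \<psi> c. (\<psi>, c) \<in> \<Psi>})"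
    and ref: "refuted d M (\<Gamma> \<union> {(i, Box \<phi>, b)} \<union> {(i, Dia \<psi>, c) | \<psi> c. (\<psi>, c) \<in> \<Psi>})"
  shows "\<exists>M'. refuted d M' (\<Gamma> \<union> {(i, Box \<phi>, b)} \<union> {(i, Dia \<psi>, c) | \<psi> c. (\<psi>, c) \<in> \<Psi>}
            \<union> {(j, \<phi>, b)} \<union> {(j, \<psi>, c) | \<psi> c. (\<psi>, c) \<in> \<Psi>})"
proof -
  let ?\<Delta> = "\<Gamma> \<union> {(i, Box \<phi>, b)} \<union> {(i, Dia \<psi>, c) | \<psi> c. (\<psi>, c) \<in> \<Psi>}"
  have M: "kripke_model M" using ref unfolding refuted_def by blast
  have box: "entry d M (i, Box \<phi>, b)" using ref unfolding refuted_def by blast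
  then obtain \<sigma> where \<sigma>: "assign M i \<notin> semS \<sigma> (Box \<phi>) M" "\<forall>u\<in>set b. pre (lim (fst u)) \<sigma> \<le> d u"
    unfolding entry_def by auto
  \<comment> \<open>A successor refuting the body of the box also refutes every
    \<open>\<psi>\<close> whose diamond fails at \<open>i\<close>; the fresh \<open>j\<close> will
    denote it.\<close>
  then obtain v where v: "(assign M i, v) \<in> acc M" "v \<notin> semS \<sigma> \<phi> M"
    using M unfolding kripke_model_def by auto
  let ?M = "M\<lparr>assign := (assign M)(j := v)\<rparr>"
  have fresh': "j \<notin> insert k (noms \<chi>)" if "(k, \<chi>, c) \<in> ?\<Delta>" for k \<chi> c
    using fresh that unfolding seq_noms_def by blast
  have old: "entry d ?M e" if "e \<in> ?\<Delta>" for e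
  proof -
    obtain k \<chi> c where e: "e = (k, \<chi>, c)" by (cases e)
    have "j \<notin> insert k (noms \<chi>)" using fresh' that unfolding e .
    then have "assign ?M k = assign M k" "semS \<sigma> \<chi> ?M = semS \<sigma> \<chi> M" for \<sigma>
      by (rule assign_update)+
    moreover have "entry d M (k, \<chi>, c)" using ref that unfolding e refuted_def by blast
    ultimately show ?thesis unfolding e by (elim entry_propagate) (simp_all only: not_False_eq_True)
  qed
  have "entry d ?M (j, \<phi>, b)"
  proof -
    have "j \<notin> insert i (noms \<phi>)" using fresh'[of i "Box \<phi>" b] by simp
    then have "assign ?M j \<notin> semS \<sigma> \<phi> ?M" using v(2) assign_update(2)[of j i \<phi> \<sigma> M v] by simp
    then show ?thesis using box \<sigma>(2) unfolding entry_def by auto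
  qed
  moreover have "entry d ?M (j, \<psi>, c)" if "(\<psi>, c) \<in> \<Psi>" for \<psi> c
  proof -
    have mem: "(i, Dia \<psi>, c) \<in> ?\<Delta>" using that by blast
    then have "entry d M (i, Dia \<psi>, c)" using ref unfolding refuted_def by blast
    moreover have "j \<notin> insert i (noms \<psi>)" using fresh'[OF mem] by simp
    then have "semS \<sigma> \<psi> ?M = semS \<sigma> \<psi> M" for \<sigma> by (rule assign_update(2))
    ultimately show ?thesis
      by (elim entry_propagate) (use v(1) M in \<open>auto simp: kripke_model_def\<close>)
  qed
  moreover have "kripke_model ?M" using M v(1) unfolding kripke_model_def by auto
  ultimately have "refuted d ?M (?\<Delta> \<union> {(j, \<phi>, b)} \<union> {(j, \<psi>, c) | \<psi> c. (\<psi>, c) \<in> \<Psi>})"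
    using ref old unfolding refuted_def by blast
  then show ?thesis by blast
qed

lemma refuted_reset:
  assumes seq: "is_sequent lt (a, \<Gamma> \<union> {(i, \<phi>, b @ [u, v] @ c) | i \<phi> v c. (i, \<phi>, v, c) \<in> \<Delta>})"
    and ref: "refuted d M (\<Gamma> \<union> {(i, \<phi>, b @ [u, v] @ c) | i \<phi> v c. (i, \<phi>, v, c) \<in> \<Delta>})"
    and u: "\<not> name_occurs u \<Gamma>" and ne: "\<Delta> \<noteq> {}" and var: "\<forall>(i, \<phi>, v, c) \<in> \<Delta>. fst v = fst u"
  shows "\<exists>l. l < d u \<and>
    refuted (d(u := l)) M (\<Gamma> \<union> {(i, \<phi>, b @ [u]) | i \<phi> v c. (i, \<phi>, v, c) \<in> \<Delta>})"
proof -
  let ?N = "{v. \<exists>i \<phi> c. (i, \<phi>, v, c) \<in> \<Delta>}"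
  \<comment> \<open>The bound of \<open>u\<close> drops to that of the names it absorbs, all of which lie below the old one.\<close>
  define l where "l = Max (d ` ?N)"
  have e: "entry d M (i, \<phi>, b @ [u, v] @ c)" and s: "subseq (b @ [u, v] @ c) a" "distinct (b @ [u, v] @ c)"
    if "(i, \<phi>, v, c) \<in> \<Delta>" for i \<phi> v c
    using that ref seq unfolding refuted_def is_sequent_def by blast+
  \<comment> \<open>The absorbed names lie in the control, so the maximum ranges over a finite set
    and is attained, at \<open>v\<^sub>0\<close>.\<close>
  have "?N \<subseteq> set a" using s(1) subseq_set_subset by fastforce
  then have fin: "finite (d ` ?N)" by (simp add: finite_subset)
  have ne': "d ` ?N \<noteq> {}" using ne by auto
  have le: "d v \<le> l" if "v \<in> ?N" for v
    unfolding l_def using fin that by (intro Max_ge) auto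
  have "l \<in> d ` ?N" unfolding l_def using fin ne' by (rule Max_in)
  then obtain i\<^sub>0 \<phi>\<^sub>0 v\<^sub>0 c\<^sub>0 where l: "l = d v\<^sub>0" "(i\<^sub>0, \<phi>\<^sub>0, v\<^sub>0, c\<^sub>0) \<in> \<Delta>" by blast
  have v\<^sub>0: "fst v\<^sub>0 = fst u" using var l(2) by blast
  have desc: "sorted_wrt (\<lambda>u v. fst u = fst v \<longrightarrow> d v < d u) (b @ [u, v\<^sub>0] @ c\<^sub>0)"
    using e[OF l(2)] unfolding entry_def by blast
  then have less: "l < d w" if "w \<in> insert u (set b)" "fst w = fst u" for w
    using that v\<^sub>0 unfolding l(1) by (auto simp: sorted_wrt_append)
  have "entry (d(u := l)) M (i, \<phi>, b @ [u])" if mem: "(i, \<phi>, v, c) \<in> \<Delta>" for i \<phi> v c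
  proof -
    have ub: "u \<notin> set b" using s(2)[OF mem] by auto
    have "subseq (b @ [u]) (b @ [u, v] @ c)" by (rule prefix_imp_subseq) simp
    then have e': "entry d M (i, \<phi>, b @ [u])" using e[OF mem] entry_subseq by blast
    obtain \<sigma> where \<sigma>: "assign M i \<notin> semS \<sigma> \<phi> M"
      "\<forall>w\<in>set (b @ [u, v] @ c). pre (lim (fst w)) \<sigma> \<le> d w"
      using e[OF mem] unfolding entry_def by blast
    have "v \<in> ?N" using mem by blast
    then have "d v \<le> l" by (rule le)
    \<comment> \<open>\<open>v\<close> names the same variable as \<open>u\<close>, so its bound
      concerns the same part of the signature and \<open>u\<close> may inherit it.\<close>
    moreover have "pre (lim (fst u)) \<sigma> \<le> d v" using \<sigma>(2) var mem by force
    ultimately have "pre (lim (fst u)) \<sigma> \<le> l" by (rule order_trans[rotated])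
    moreover have "sorted_wrt (\<lambda>v w. fst v = fst w \<longrightarrow> (d(u := l)) w < (d(u := l)) v) (b @ [u])"
      using sorted_wrt_snoc_update[OF ub, of d l] desc less by (auto simp: sorted_wrt_append)
    ultimately show ?thesis using e' \<sigma> ub unfolding entry_def by auto
  qed
  moreover have "entry (d(u := l)) M e" if "e \<in> \<Gamma>" for e
  proof -
    obtain k \<chi> a where e: "e = (k, \<chi>, a)" by (cases e)
    then have "u \<notin> set a" using u that unfolding name_occurs_def by blast
    then show ?thesis using ref that entry_update unfolding e refuted_def by blast
  qed
  moreover have len: "length ((d(u := l)) w) = lim (fst w)" for w
  proof -
    have "\<forall>w. length (d w) = lim (fst w)" using ref unfolding refuted_def by blast
    then show ?thesis using v\<^sub>0 l(1) by (metis fun_upd_apply)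
  qed
  ultimately have "refuted (d(u := l)) M (\<Gamma> \<union> {(i, \<phi>, b @ [u]) | i \<phi> v c. (i, \<phi>, v, c) \<in> \<Delta>})"
    using ref len unfolding refuted_def by blast
  then show ?thesis using less by blast
qed

text \<open>The comparison is confined to names in the control of the conclusion, since
  \<open>RRec\<close> gives a fresh name a new, possibly larger bound.\<close>

lemma local_soundness:
  assumes "saf_rule lt r Ps C" "is_sequent lt C" "refuted d M (snd C)"
  shows "\<exists>P\<in>set Ps. \<exists>d' M'. refuted d' M' (snd P) \<and>
    (\<forall>u\<in>set (fst C). d' u \<le> d u) \<and> (\<forall>u. r = RReset u \<longrightarrow> d' u < d u)"
  using assms
proof (cases rule: saf_rule.cases)
  case (conj a \<Gamma> i \<phi> \<psi> b)
  have "entry d M (i, And \<phi> \<psi>, b)" using assms(3) conj unfolding refuted_def by simp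
  then have "entry d M (i, \<phi>, b) \<or> entry d M (i, \<psi>, b)" unfolding entry_def by auto
  then have "\<exists>P\<in>set Ps. refuted d M (snd P)" using assms(3) conj unfolding refuted_def by auto
  then show ?thesis using conj by blast
next
  case (disj a \<Gamma> i \<phi> \<psi> b)
  have e: "entry d M (i, Or \<phi> \<psi>, b)" using assms(3) disj unfolding refuted_def by simp
  have "entry d M (i, \<phi>, b)" "entry d M (i, \<psi>, b)" by (rule entry_propagate[OF e]; simp)+
  then have "\<exists>P\<in>set Ps. refuted d M (snd P)" using assms(3) disj unfolding refuted_def by auto
  then show ?thesis using disj by blast
next
  case (eq a \<Gamma> i \<phi> b j c)
  have e: "entry d M (j, \<phi>, b)" "entry d M (i, NNom j, c)" and M: "kripke_model M"
    using assms(3) eq unfolding refuted_def by simp_all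
  have "assign M i = assign M j" using e(2) M unfolding entry_def kripke_model_def by auto
  then have "entry d M (i, \<phi>, b)" using e(1) by (elim entry_propagate) auto
  then have "\<exists>P\<in>set Ps. refuted d M (snd P)" using assms(3) eq unfolding refuted_def by auto
  then show ?thesis using eq by blast
next
  case (com a \<Gamma> i j c)
  have e: "entry d M (i, NNom j, c)" and M: "kripke_model M"
    using assms(3) com unfolding refuted_def by simp_all
  have "entry d M (j, NNom i, c)"
    by (rule entry_propagate[OF e]) (use M in \<open>auto simp: kripke_model_def\<close>)
  then have "\<exists>P\<in>set Ps. refuted d M (snd P)" using assms(3) com unfolding refuted_def by auto
  then show ?thesis using com by blast
next
  case (modal j \<Gamma> i \<phi> b \<Psi> a)
  show ?thesis
    using refuted_modal[OF modal(4), of d M] assms(3) unfolding modal(1-3) by auto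
next
  case (fixp b x a \<Gamma> i \<eta> \<phi>)
  have "entry d M (i, Fix \<eta> x \<phi>, b)" "kripke_model M"
    using assms(3) fixp unfolding refuted_def by simp_all
  then have "entry d M (i, unfold_fix \<eta> x \<phi>, b)" using entry_unfold(1) fixp(4) by blast
  then have "\<exists>P\<in>set Ps. refuted d M (snd P)" using assms(3) fixp unfolding refuted_def by auto
  then show ?thesis using fixp by blast
next
  case (glob a \<Gamma> i j \<phi> b)
  have e: "entry d M (i, At j \<phi>, b)" and M: "kripke_model M"
    using assms(3) glob unfolding refuted_def by simp_all
  have "entry d M (j, \<phi>, b)"
    by (rule entry_propagate[OF e]) (use M in \<open>auto simp: kripke_model_def\<close>)
  then have "\<exists>P\<in>set Ps. refuted d M (snd P)" using assms(3) glob unfolding refuted_def by auto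
  then show ?thesis using glob by blast
next
  case (rec_nu b x n a \<Gamma> i \<phi>)
  let ?u = "(x, n)"
  have e: "entry d M (i, Fix Nu x \<phi>, b)" and M: "kripke_model M"
    using assms(3) rec_nu unfolding refuted_def by simp_all
  \<comment> \<open>Annotations are subsequences of the control, so a name new to the control can be
    reinterpreted freely.\<close>
  have fresh: "?u \<notin> set c" if "(k, \<chi>, c) \<in> snd C" for k \<chi> c
  proof -
    have "\<forall>(i, \<phi>, b)\<in>snd C. subseq b a" using assms(2) unfolding rec_nu(3) is_sequent_def by auto
    then show ?thesis using that rec_nu(5) subseq_set_subset[of c a] by blast
  qed
  then have "?u \<notin> set b" using rec_nu(3) by auto
  then obtain l where l: "length l = lim x"
    "entry (d(?u := l)) M (i, unfold_fix Nu x \<phi>, b @ [?u])"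
    using entry_unfold(2)[OF e rec_nu(4) M, of ?u] by auto
  have "entry (d(?u := l)) M f" if "f \<in> snd C" for f
  proof -
    obtain k \<chi> c where "f = (k, \<chi>, c)" by (cases f)
    then show ?thesis using fresh that entry_update assms(3) unfolding refuted_def by blast
  qed
  then have "refuted (d(?u := l)) M (snd (hd Ps))"
    using l assms(3) rec_nu unfolding refuted_def by simp
  moreover have "\<forall>u\<in>set (fst C). (d(?u := l)) u \<le> d u" using rec_nu by auto
  ultimately show ?thesis using rec_nu by auto
next
  case (exp a a' \<Delta>)
  have "entry d M (i, \<phi>, b)" if "(i, \<phi>, b, b') \<in> \<Delta>" for i \<phi> b b'
    using that assms(3) exp entry_subseq unfolding refuted_def by fastforce
  then have "\<exists>P\<in>set Ps. refuted d M (snd P)" using assms(3) exp unfolding refuted_def by auto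
  then show ?thesis using exp by blast
next
  case (reset u \<Gamma> \<Delta> a b)
  obtain l where l: "l < d u"
    and ref: "refuted (d(u := l)) M (\<Gamma> \<union> {(i, \<phi>, b @ [u]) | i \<phi> v c. (i, \<phi>, v, c) \<in> \<Delta>})"
    using refuted_reset[OF assms(2)[unfolded reset(3)] assms(3)[unfolded reset(3) snd_conv] reset(4-6)]
    by blast
  have "\<exists>P\<in>set Ps. refuted (d(u := l)) M (snd P)" using ref unfolding reset(2) by simp
  moreover have "\<forall>v. (d(u := l)) v \<le> d v" "\<forall>v. r = RReset v \<longrightarrow> (d(u := l)) v < d v"
    using l reset(1) by auto
  ultimately show ?thesis by blast
next
  case (weak a \<Gamma> \<Psi>)
  then have "\<exists>P\<in>set Ps. refuted d M (snd P)" using assms(3) unfolding refuted_def by auto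
  then show ?thesis using weak by blast
qed

end

section \<open>Infinite runs through a cyclic proof\<close>

lemma switch:
  fixes n m :: nat
  assumes "P n" "\<not> P m" "n \<le> m"
  shows "\<exists>t\<ge>n. t < m \<and> P t \<and> \<not> P (Suc t)"
  using assms(2,3)
proof (induction m)
  case (Suc m)
  then show ?case using assms(1) by (cases "P m") (auto simp: le_Suc_eq less_Suc_eq)
qed (use assms(1) in auto)

text \<open>The lexicographic order on lists of one length is well-founded, and a minimal value of
  the tail would be undercut by the next strict decrease.\<close>

lemma no_infinite_lex_descent:
  fixes a :: "nat \<Rightarrow> 'a::wellorder list"
  assumes len: "\<And>n. length (a n) = k" and le: "\<And>n. n \<ge> N \<Longrightarrow> a (Suc n) \<le> a n"
    and less: "\<And>m. \<exists>n\<ge>m. a (Suc n) < a n"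
  shows False
proof -
  have "wf (lex {(x :: 'a, y). x < y})" by (intro wf_lex wf)
  then obtain z where z: "z \<in> a ` {N..}" "\<And>y. (y, z) \<in> lex {(x, y). x < y} \<Longrightarrow> y \<notin> a ` {N..}"
    by (rule wfE_min[where Q = "a ` {N..}"]) auto
  from z(1) obtain n\<^sub>0 where n\<^sub>0: "n\<^sub>0 \<ge> N" "z = a n\<^sub>0" by auto
  obtain n where n: "n \<ge> n\<^sub>0" "a (Suc n) < a n" using less by blast
  have "a n \<le> a n\<^sub>0"
    using n(1)
  proof (induction rule: dec_induct)
    case (step m)
    then show ?case using le[of m] n\<^sub>0(1) by (meson order_trans)
  qed simp
  then have "a (Suc n) < z" using n(2) n\<^sub>0(2) by simp
  then have "(a (Suc n), z) \<in> lex {(x, y). x < y}"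
    using len n\<^sub>0(2) by (simp add: lexord_lex list_less_def)
  moreover have "a (Suc n) \<in> a ` {N..}" using n(1) n\<^sub>0(1) by (intro imageI) simp
  ultimately show False using z(2) by blast
qed

section \<open>Order of names in the control\<close>

lemma saf_rule_control:
  assumes "saf_rule lt r Ps C" "P \<in> set Ps"
  shows "subseq (fst P) (fst C) \<or> (\<exists>u. u \<notin> set (fst C) \<and> fst P = fst C @ [u])"
  using assms by (cases rule: saf_rule.cases) auto

definition before :: "'a \<Rightarrow> 'a list \<Rightarrow> 'a list" where
  "before u c = takeWhile (\<lambda>v. v \<noteq> u) c"

lemma take_before:
  assumes "u \<in> set c"
  shows "take (Suc (length (before u c))) c = before u c @ [u]"
  using assms unfolding before_def by (induction c) auto

lemma before_append: "u \<notin> set xs \<Longrightarrow> before u (xs @ u # ys) = xs"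
  unfolding before_def by (subst takeWhile_append2) auto

lemma before_subseq:
  assumes "distinct c" "subseq c' c" "u \<in> set c'"
  shows "subseq (before u c') (before u c)"
proof -
  have "u \<in> set c" using assms(2,3) subseq_set_subset by blast
  then obtain xs ys where c: "c = xs @ u # ys" "u \<notin> set xs" by (meson split_list_first)
  have "before u c = xs" using c before_append by simp
  moreover have "c' = filter (\<lambda>v. v \<in> set c') c" using subseq_distinct_eq_filter assms(1,2) by metis
  then have "before u c' = before u (filter (\<lambda>v. v \<in> set c') xs @ [u] @ filter (\<lambda>v. v \<in> set c') ys)"
    using c(1) assms(3) by simp
  then have "before u c' = filter (\<lambda>v. v \<in> set c') xs" using c(2) by (simp add: before_append)
  ultimately show ?thesis by simp
qed

lemma before_snoc: "u \<in> set c \<Longrightarrow> before u (c @ [v]) = before u c"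
  unfolding before_def by simp

text \<open>The run \<open>s\<close> moves from a node to a child, or from an open leaf along its
  back-edge; \<open>g l\<close> is the name that makes the loop at \<open>l\<close> good.\<close>

locale cyclic_run =
  fixes lt :: var_order and T :: saf_tree and f :: "nat list \<Rightarrow> nat list"
    and g :: "nat list \<Rightarrow> name" and s :: "nat \<Rightarrow> nat list"
  assumes saf_proof: "saf_proof lt T" and finite_nodes: "finite (nodes T)"
    and back_edges: "back_edge_map T f"
    and preserved: "\<And>l q. open_leaf T l \<Longrightarrow> prefix (f l) q \<Longrightarrow> prefix q l \<Longrightarrow>
      g l \<in> set (fst (sequent_at T q))"
    and resets: "\<And>l. open_leaf T l \<Longrightarrow>
      \<exists>q. prefix (f l) q \<and> strict_prefix q l \<and> rule_at T q = RReset (g l)"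
    and nodes: "\<And>n. s n \<in> nodes T"
    and step: "\<And>n. open_leaf T (s n) \<and> s (Suc n) = f (s n) \<or>
      \<not> is_leaf T (s n) \<and> (\<exists>k. s (Suc n) = s n @ [k])"
begin

abbreviation ctrl :: "nat list \<Rightarrow> name list" where
  "ctrl q \<equiv> fst (sequent_at T q)"

lemma prefix_node: "prefix p q \<Longrightarrow> q \<in> nodes T \<Longrightarrow> p \<in> nodes T"
proof -
  have "p @ r \<in> nodes T \<Longrightarrow> p \<in> nodes T" for r
  proof (induction r rule: rev_induct)
    case (snoc k r)
    then have "(p @ r) @ [k] \<in> nodes T" by simp
    then show ?case using snoc.IH saf_proof unfolding saf_proof_def by blast
  qed simp
  then show "prefix p q \<Longrightarrow> q \<in> nodes T \<Longrightarrow> p \<in> nodes T" by (auto elim: prefixE)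
qed

text \<open>From conclusion to premise, names are only deleted or appended at the end, so what
  precedes a surviving name can only shrink.\<close>

lemma before_step:
  assumes "q @ [k] \<in> nodes T" "u \<in> set (ctrl (q @ [k]))" "u \<in> set (ctrl q)"
  shows "subseq (before u (ctrl (q @ [k]))) (before u (ctrl q))"
proof -
  have q: "q \<in> nodes T" "\<not> is_leaf T q"
    using assms(1) saf_proof unfolding saf_proof_def is_leaf_def by blast+
  then obtain m where m: "\<forall>k. q @ [k] \<in> nodes T \<longleftrightarrow> k < m"
    "saf_rule lt (rule_at T q) (map (\<lambda>k. sequent_at T (q @ [k])) [0..<m]) (sequent_at T q)"
    using saf_proof unfolding saf_proof_def by blast
  have "is_sequent lt (sequent_at T q)" using q saf_proof unfolding saf_proof_def by blast
  then have "distinct (ctrl q)" unfolding is_sequent_def by (auto split: prod.splits)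
  moreover have "sequent_at T (q @ [k]) \<in> set (map (\<lambda>k. sequent_at T (q @ [k])) [0..<m])"
    using m(1) assms(1) by auto
  note saf_rule_control[OF m(2) this]
  ultimately show ?thesis
    using before_subseq[of "ctrl q" _ u] before_snoc[of u "ctrl q"] assms(2,3) by auto
qed

lemma before_path:
  assumes "prefix p q" "q \<in> nodes T" "\<And>r. prefix p r \<Longrightarrow> prefix r q \<Longrightarrow> u \<in> set (ctrl r)"
  shows "subseq (before u (ctrl q)) (before u (ctrl p))"
proof -
  from assms(1) obtain r where "q = p @ r" by (rule prefixE)
  then show ?thesis
    using assms(2,3)
  proof (induction r arbitrary: q rule: rev_induct)
    case (snoc k r)
    let ?q = "p @ r"
    have q: "q = ?q @ [k]" using snoc.prems(1) by simp
    have "subseq (before u (ctrl ?q)) (before u (ctrl p))"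
    proof (rule snoc.IH)
      show "?q \<in> nodes T" using snoc.prems(2) prefix_node q by (metis prefixI)
      show "u \<in> set (ctrl r')" if "prefix p r'" "prefix r' ?q" for r'
        using that prefix_order.trans[of r' ?q q] q by (intro snoc.prems(3)) auto
    qed simp
    moreover have "subseq (before u (ctrl q)) (before u (ctrl ?q))"
      using snoc.prems unfolding q by (intro before_step) auto
    ultimately show ?case by (rule subseq_order.order_trans[rotated])
  qed simp
qed

text \<open>New names are appended and the control at both ends of a loop is the same, so no name in
  front of the preserved name \<open>g l\<close> can get lost on the loop: all names up to \<open>g l\<close> are preserved.\<close>

definition pos :: "nat list \<Rightarrow> nat" where
  "pos l = length (before (g l) (ctrl l))"

text \<open>Allowing every \<open>K\<close> up to \<open>pos l\<close> lets several loops share one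
  initial part.\<close>

lemma loop_take:
  assumes l: "open_leaf T l" and q: "prefix (f l) q" "prefix q l" and K: "K \<le> pos l"
  shows "take (Suc K) (ctrl q) = take (Suc K) (ctrl l)"
proof -
  let ?u = "g l"
  have l': "l \<in> nodes T" using l unfolding open_leaf_def is_leaf_def by blast
  have same: "ctrl (f l) = ctrl l" using back_edges l unfolding back_edge_map_def by metis
  have "subseq (before ?u (ctrl l)) (before ?u (ctrl q))"
    by (rule before_path[OF q(2) l']) (use preserved[OF l] q prefix_order.trans in blast)
  moreover have "subseq (before ?u (ctrl q)) (before ?u (ctrl (f l)))"
    by (rule before_path[OF q(1) prefix_node[OF q(2) l']])
      (use preserved[OF l] q prefix_order.trans in blast)
  ultimately have eq: "before ?u (ctrl q) = before ?u (ctrl l)"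
    unfolding same by (rule subseq_order.antisym[rotated])
  have "?u \<in> set (ctrl q)" "?u \<in> set (ctrl l)" using preserved[OF l] q prefix_order.trans by blast+
  then have "take (Suc (pos l)) (ctrl q) = take (Suc (pos l)) (ctrl l)"
    unfolding pos_def using take_before[of ?u] eq by metis
  then have "take (Suc K) (take (Suc (pos l)) (ctrl q)) = take (Suc K) (take (Suc (pos l)) (ctrl l))"
    by simp
  then show ?thesis using K by (simp add: min_absorb1)
qed

text \<open>A back-edge leads to a prefix of the current node and so cannot enter a subtree from
  outside; only a step to the child \<open>q\<close> can.\<close>

lemma enter:
  assumes "n \<le> m" "\<not> prefix q (s n)" "prefix q (s m)"
  shows "\<exists>t\<ge>n. s t = q"
proof -
  obtain t where t: "t \<ge> n" "\<not> prefix q (s t)" "prefix q (s (Suc t))"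
    using switch[of "\<lambda>n. \<not> prefix q (s n)" n m] assms by auto
  have "prefix (f (s t)) (s t)" if "open_leaf T (s t)" using back_edges that unfolding back_edge_map_def by blast
  then have "\<exists>k. s (Suc t) = s t @ [k]" using step[of t] t prefix_order.trans by metis
  then have "s (Suc t) = q" using t(2,3) by auto
  then show ?thesis using t(1) le_SucI by blast
qed

text \<open>Steps to children stay in the subtree, so it is left by a back-edge.\<close>

lemma exit:
  assumes "n \<le> m" "prefix q (s n)" "\<not> prefix q (s m)"
  shows "\<exists>t\<ge>n. open_leaf T (s t) \<and> prefix q (s t) \<and> strict_prefix (f (s t)) q"
proof -
  obtain t where t: "t \<ge> n" "prefix q (s t)" "\<not> prefix q (s (Suc t))"
    using switch[of "\<lambda>n. prefix q (s n)" n m] assms by auto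
  then have l: "open_leaf T (s t)" "s (Suc t) = f (s t)" using step[of t] by auto
  then have "prefix (f (s t)) (s t)" using back_edges unfolding back_edge_map_def by blast
  then have "strict_prefix (f (s t)) q"
    using t(2,3) l(2) prefix_same_cases prefix_order.le_neq_trans by fastforce
  then show ?thesis using t l by blast
qed

text \<open>The finitely many nodes visited only finitely often are all avoided from some point
  on.\<close>

lemma eventually_recurrent: "\<exists>N. \<forall>n\<ge>N. \<forall>m. \<exists>k\<ge>m. s k = s n"
proof -
  let ?I = "{q. \<forall>m. \<exists>n\<ge>m. s n = q}"
  have "\<forall>q\<in>nodes T - ?I. \<forall>\<^sub>F n in sequentially. s n \<noteq> q"
    unfolding eventually_sequentially by blast
  then have "\<forall>\<^sub>F n in sequentially. \<forall>q\<in>nodes T - ?I. s n \<noteq> q"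
    using finite_nodes by (intro eventually_ball_finite) auto
  then obtain N where N: "\<forall>n\<ge>N. \<forall>q\<in>nodes T - ?I. s n \<noteq> q"
    unfolding eventually_sequentially by blast
  have "s n \<in> ?I" if "n \<ge> N" for n using N nodes that by blast
  then show ?thesis by blast
qed

lemma persistent_name:
  "\<exists>u N. (\<forall>n\<ge>N. u \<in> set (ctrl (s n))) \<and>
    (\<forall>m. \<exists>n\<ge>m. \<not> is_leaf T (s n) \<and> rule_at T (s n) = RReset u)"
proof -
  obtain N where N: "\<And>n m. n \<ge> N \<Longrightarrow> \<exists>k\<ge>m. s k = s n" using eventually_recurrent by blast
  define L where "L = {l. open_leaf T l \<and> l \<in> s ` {N..}}"
  \<comment> \<open>Without back-edges in the tail the addresses would grow forever, yet
    \<open>s N\<close> recurs.\<close>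
  have "L \<noteq> {}"
  proof
    assume "L = {}"
    then have child: "\<exists>k. s (Suc n) = s n @ [k]" if "n \<ge> N" for n
      using step[of n] that unfolding L_def by auto
    have len: "length (s (N + n)) = length (s N) + n" for n
    proof (induction n)
      case (Suc n)
      then show ?case using child[of "N + n"] by auto
    qed simp
    obtain k where "k \<ge> Suc N" "s k = s N" using N by blast
    then show False using len[of "k - N"] by simp
  qed
  \<comment> \<open>Of all loops used infinitely often, take one whose preserved name stands first in the control:
    the others preserve that initial part of the control as well.\<close>
  then obtain l where l: "l \<in> L" and min: "\<And>l'. l' \<in> L \<Longrightarrow> pos l \<le> pos l'"
    using ex_has_least_nat[of "\<lambda>l. l \<in> L" _ pos] by blast
  have leaf: "open_leaf T l" "is_leaf T l" using l unfolding L_def open_leaf_def by auto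
  have recur: "\<exists>k\<ge>m. s k = l" for m using l N unfolding L_def by auto
  let ?K = "pos l" and ?u = "g l"
  have const: "take (Suc ?K) (ctrl (s (Suc n))) = take (Suc ?K) (ctrl (s n))" if n: "n \<ge> N" for n
    using step[of n]
  proof
    assume "open_leaf T (s n) \<and> s (Suc n) = f (s n)"
    then show ?thesis using back_edges unfolding back_edge_map_def by metis
  next
    assume "\<not> is_leaf T (s n) \<and> (\<exists>k. s (Suc n) = s n @ [k])"
    then obtain k where k: "s (Suc n) = s n @ [k]" by blast
    \<comment> \<open>The run returns to \<open>s n\<close>, so it leaves the subtree of the child
      by a back-edge. The loop closed by that back-edge contains both \<open>s n\<close> and the
      child, hence fixes the initial part at both.\<close>
    obtain m where m: "m \<ge> Suc n" "s m = s n" using N n by blast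
    obtain t where t: "t \<ge> Suc n" "open_leaf T (s t)" "prefix (s n @ [k]) (s t)"
      "strict_prefix (f (s t)) (s n @ [k])"
      using exit[OF m(1), of "s n @ [k]"] m(2) k by auto
    have "s t \<in> L" using t n unfolding L_def by auto
    then have K: "?K \<le> pos (s t)" by (rule min)
    have "prefix (f (s t)) (s n)" using t(4) by (auto simp: strict_prefix_def)
    moreover have "prefix (s n) (s n @ [k])" by simp
    ultimately show ?thesis
      unfolding k using loop_take[OF t(2) _ _ K] t(3) prefix_order.trans by metis
  qed
  have const': "take (Suc ?K) (ctrl (s n)) = take (Suc ?K) (ctrl (s N))" if "n \<ge> N" for n
    using that by (induction rule: dec_induct) (simp_all add: const)
  have "?u \<in> set (ctrl l)" using preserved[OF leaf(1)] back_edges leaf(1) unfolding back_edge_map_def by blast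
  then have "?u \<in> set (take (Suc ?K) (ctrl l))" unfolding pos_def by (simp add: take_before)
  then have "?u \<in> set (take (Suc ?K) (ctrl (s n)))" if "n \<ge> N" for n
    using const' that recur[of N] by metis
  then have always: "?u \<in> set (ctrl (s n))" if "n \<ge> N" for n using that in_set_takeD by metis
  obtain q where q: "prefix (f l) q" "strict_prefix q l" "rule_at T q = RReset ?u"
    using resets[OF leaf(1)] by blast
  have "\<not> is_leaf T q"
  proof -
    obtain k r where "l = q @ k # r" using q(2) by (rule strict_prefixE')
    then have "prefix (q @ [k]) l" by simp
    then have "q @ [k] \<in> nodes T" using prefix_node leaf(2) unfolding is_leaf_def by blast
    then show ?thesis unfolding is_leaf_def by blast
  qed
  \<comment> \<open>After each jump from \<open>l\<close> to \<open>f l\<close> the run comes back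
    to \<open>l\<close>, which lies below \<open>q\<close>; so it passes \<open>q\<close>, possibly
    already at \<open>f l\<close>.\<close>
  moreover have "\<exists>n\<ge>m. s n = q" for m
  proof -
    obtain n where n: "n \<ge> m" "s n = l" using recur by blast
    have fl: "s (Suc n) = f l" using step[of n] n(2) leaf(2) by auto
    obtain n' where n': "n' \<ge> Suc n" "s n' = l" using recur by blast
    show ?thesis
    proof (cases "prefix q (f l)")
      case True
      then have "q = f l" using q(1) prefix_order.antisym by blast
      then show ?thesis using fl n(1) le_SucI by metis
    next
      case False
      then obtain t where "t \<ge> Suc n" "s t = q" using enter[OF n'(1), of q] fl n'(2) q(2) prefix_order.less_imp_le by auto
      then show ?thesis using n(1) by (intro exI[of _ t]) simp
    qed
  qed
  ultimately show ?thesis using always q(3) by metis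
qed

end

section \<open>Soundness\<close>

lemma subforms_refl: "\<phi> \<in> subforms \<phi>"
  by (cases \<phi>) auto

lemma subforms_trans: "\<psi> \<in> subforms \<phi> \<Longrightarrow> subforms \<psi> \<subseteq> subforms \<phi>"
  by (induction \<phi>) auto

lemma finite_subforms: "finite (subforms \<phi>)"
  by (induction \<phi>) auto

lemma size_subforms: "\<psi> \<in> subforms \<phi> \<Longrightarrow> size \<psi> \<le> size \<phi>"
  by (induction \<phi>) auto

lemma finite_bv: "finite (bv \<phi>)"
proof -
  have "bv \<phi> \<subseteq> (\<lambda>\<psi>. case \<psi> of Fix \<eta> x \<chi> \<Rightarrow> x | _ \<Rightarrow> 0) ` subforms \<phi>"
    unfolding bv_def bv_of_def by force
  then show ?thesis using finite_subforms finite_surj by blast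
qed

lemma (in fixpoint_order) ht_le_size: "ht x \<phi> \<le> size \<phi>"
  by (induction \<phi>) auto

lemma (in fixpoint_order) ok_formula:
  assumes "formula \<phi>" "dep \<phi> \<subseteq> lt" "V = bv \<phi>" "size \<phi> < B"
  shows "ok \<phi>"
proof -
  have "\<psi> \<in> subforms \<phi> \<Longrightarrow> ok \<psi>" for \<psi>
  proof (induction \<psi>)
    case (Fix \<eta> x \<psi>)
    have "\<psi> \<in> subforms \<phi>" using subforms_trans[OF Fix.prems] subforms_refl by auto
    then have "ok \<psi>" "size \<psi> \<le> size \<phi>" using Fix.IH size_subforms by auto
    moreover have "x \<notin> neg_fv \<psi>" using assms(1) Fix.prems unfolding formula_def by blast
    moreover have x: "x \<in> V"
      using Fix.prems unfolding assms(3) bv_def bv_of_def by (cases \<eta>) auto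
    moreover have "(z, x) \<in> lt" if "z \<in> V" "z \<in> fv \<psi> - {x}" for z
    proof -
      have "(z, x) \<in> dep \<phi>" using that x Fix.prems assms(3) unfolding dep_def by auto
      then show ?thesis using assms(2) by blast
    qed
    ultimately show ?case using assms(4) ht_le_size[of x \<psi>] by auto
  qed (use subforms_trans subforms_refl in \<open>fastforce+\<close>)
  then show ?thesis using subforms_refl by blast
qed

text \<open>An axiom cannot be refuted, so a leaf reached is open; its back-edge leads to the same
  sequent, refuted by the same bounds and model.\<close>

lemma (in fixpoint_order) refuted_step:
  assumes tree: "saf_proof lt T" and back_edges: "back_edge_map T f"
    and q: "q \<in> nodes T" and ref: "refuted d M (snd (sequent_at T q))"
  shows "\<exists>q' d' M'. q' \<in> nodes T \<and> refuted d' M' (snd (sequent_at T q')) \<and>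
    (open_leaf T q \<and> q' = f q \<or> \<not> is_leaf T q \<and> (\<exists>k. q' = q @ [k])) \<and>
    (\<forall>u\<in>set (fst (sequent_at T q)). d' u \<le> d u) \<and>
    (\<not> is_leaf T q \<longrightarrow> (\<forall>u. rule_at T q = RReset u \<longrightarrow> d' u < d u))"
proof (cases "is_leaf T q")
  case True
  have "\<not> saf_axiom (sequent_at T q)"
  proof
    assume "saf_axiom (sequent_at T q)"
    then show False using ref unfolding refuted_def kripke_model_def
      by cases (auto simp: entry_def)
  qed
  then have "open_leaf T q" using True unfolding open_leaf_def by blast
  then show ?thesis
    using back_edges ref True unfolding back_edge_map_def by (intro exI[of _ "f q"] exI[of _ d] exI[of _ M]) auto
next
  case False
  then obtain m where m: "\<forall>k. q @ [k] \<in> nodes T \<longleftrightarrow> k < m"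
    "saf_rule lt (rule_at T q) (map (\<lambda>k. sequent_at T (q @ [k])) [0..<m]) (sequent_at T q)"
    using tree q unfolding saf_proof_def by blast
  have "is_sequent lt (sequent_at T q)" using q tree unfolding saf_proof_def by blast
  then obtain P d' M' where P: "P \<in> set (map (\<lambda>k. sequent_at T (q @ [k])) [0..<m])"
    and d': "refuted d' M' (snd P)" "\<forall>u\<in>set (fst (sequent_at T q)). d' u \<le> d u"
      "\<forall>u. rule_at T q = RReset u \<longrightarrow> d' u < d u"
    using local_soundness[OF m(2) _ ref] by blast
  obtain k where "k < m" "P = sequent_at T (q @ [k])" using P by auto
  then show ?thesis using d' m(1) False by blast
qed

lemma (in fixpoint_order) not_refuted:
  assumes valid: "valid_saf_proof lt T"
  shows "\<not> refuted d M (snd (sequent_at T []))"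
proof
  assume ref: "refuted d M (snd (sequent_at T []))"
  obtain f where tree: "saf_proof lt T" "finite (nodes T)" and f: "good_back_edge_map T f"
    using valid unfolding valid_saf_proof_def by blast
  then have back_edges: "back_edge_map T f" unfolding good_back_edge_map_def by blast
  have "\<forall>l. \<exists>u. open_leaf T l \<longrightarrow>
      (\<forall>q. prefix (f l) q \<and> prefix q l \<longrightarrow> u \<in> set (fst (sequent_at T q))) \<and>
      (\<exists>q. prefix (f l) q \<and> strict_prefix q l \<and> rule_at T q = RReset u)"
    using f unfolding good_back_edge_map_def by blast
  then obtain g where g: "\<And>l. open_leaf T l \<Longrightarrow>
      (\<forall>q. prefix (f l) q \<and> prefix q l \<longrightarrow> g l \<in> set (fst (sequent_at T q))) \<and>
      (\<exists>q. prefix (f l) q \<and> strict_prefix q l \<and> rule_at T q = RReset (g l))"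
    by metis
  define Inv where "Inv = (\<lambda>(q, d, M :: 'a kripke). q \<in> nodes T \<and> refuted d M (snd (sequent_at T q)))"
  define R where "R = (\<lambda>(q, d :: name \<Rightarrow> 'a stage list, M :: 'a kripke) (q', d', M' :: 'a kripke).
    (open_leaf T q \<and> q' = f q \<or> \<not> is_leaf T q \<and> (\<exists>k. q' = q @ [k])) \<and>
    (\<forall>u\<in>set (fst (sequent_at T q)). d' u \<le> d u) \<and>
    (\<not> is_leaf T q \<longrightarrow> (\<forall>u. rule_at T q = RReset u \<longrightarrow> d' u < d u)))"
  have "Inv ([], d, M)" using ref tree(1) unfolding Inv_def saf_proof_def by simp
  moreover have "\<exists>y. Inv y \<and> R x y" if "Inv x" for x
  proof -
    obtain q d M where x: "x = (q, d, M)" by (cases x)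
    show ?thesis
      using refuted_step[OF tree(1) back_edges, of q d M] that unfolding x Inv_def R_def by auto
  qed
  ultimately obtain h where h: "\<And>n. Inv (h n)" "\<And>n. R (h n) (h (Suc n))"
    using dependent_nat_choice[of "\<lambda>_. Inv" "\<lambda>_. R"] by blast
  define s e where "s n = fst (h n)" and "e n = fst (snd (h n))" for n
  have run: "s n \<in> nodes T" "\<forall>u. length (e n u) = lim (fst u)"
    "open_leaf T (s n) \<and> s (Suc n) = f (s n) \<or> \<not> is_leaf T (s n) \<and> (\<exists>k. s (Suc n) = s n @ [k])"
    "\<forall>u\<in>set (fst (sequent_at T (s n))). e (Suc n) u \<le> e n u"
    "\<not> is_leaf T (s n) \<longrightarrow> (\<forall>u. rule_at T (s n) = RReset u \<longrightarrow> e (Suc n) u < e n u)" for n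
    using h(1)[of n] h(2)[of n] unfolding Inv_def R_def s_def e_def refuted_def by (auto split: prod.splits)
  interpret cyclic_run lt T f g s
    by unfold_locales (use tree back_edges g run(1,3) in blast)+
  obtain u N where u: "\<forall>n\<ge>N. u \<in> set (fst (sequent_at T (s n)))"
    "\<forall>m. \<exists>n\<ge>m. \<not> is_leaf T (s n) \<and> rule_at T (s n) = RReset u"
    using persistent_name by blast
  show False
    by (rule no_infinite_lex_descent[of "\<lambda>n. e n u" "lim (fst u)" N]) (use u run in blast)+
qed

theorem mainTheorem2:
  fixes \<rho> :: form and M :: "'w kripke" and w :: 'w
  assumes "formula \<rho>"
    and "has_valid_saf_proof \<rho>"
    and "kripke_model M"
    and "w \<in> worlds M"
  shows "w \<in> sem \<rho> M"
proof (rule ccontr)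
  assume w: "w \<notin> sem \<rho> M"
  obtain lt r T where lt: "linearization \<rho> lt" and r: "r \<notin> noms \<rho>"
    and T: "valid_saf_proof lt T" "sequent_at T [] = ([], {(r, \<rho>, [])})"
    using assms(2) unfolding has_valid_saf_proof_def by blast
  \<comment> \<open>All heights in the root formula are at most its size, whence this value of
    \<open>B\<close>.\<close>
  interpret fixpoint_order lt "bv \<rho>" "Suc (size \<rho>)"
    using lt finite_bv unfolding linearization_def strict_linear_order_on_def
    by unfold_locales (auto dest: transD irreflD simp: total_on_def)
  have ok: "ok \<rho>"
    by (rule ok_formula) (use assms(1) lt in \<open>auto simp: linearization_def\<close>)
  \<comment> \<open>The root nominal is made to denote \<open>w\<close>; as it does not occur in
    \<open>\<rho>\<close>, the meaning of \<open>\<rho>\<close> is unaffected.\<close>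
  let ?M = "M\<lparr>assign := (assign M)(r := w)\<rparr>"
  have "w \<notin> semS (\<lambda>_. Infty) \<rho> M" using w semS_Infty[of \<rho> M] by (meson subsetD)
  moreover have "semS (\<lambda>_. Infty) \<rho> ?M = semS (\<lambda>_. Infty) \<rho> M"
    by (rule semS_cong) (use r in auto)
  ultimately have "assign ?M r \<notin> semS (\<lambda>_. Infty) \<rho> ?M" by simp
  moreover have "kripke_model ?M" using assms(3,4) unfolding kripke_model_def by simp
  ultimately have "refuted (\<lambda>u. pre (lim (fst u)) (\<lambda>_. Infty)) ?M (snd (sequent_at T []))"
    unfolding refuted_def entry_def T(2) using ok by auto
  then show False using not_refuted[OF T(1)] by blast
qed

end
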